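(* Let $n\ge1$, let $L\subseteq\{0,1,\dots,n-1\}$, $S_1=\{a^{2l}b,\ a^{-2l}b^2\mid l\in L\}$, and $S_2\subseteq\langle a^2\rangle a\cup\langle a^2\rangle ab\cup\langle a^2\rangle ab^2$, such that $S=S_1\cup S_2\subseteq U_{6n}$ satisfies $1\notin S=S^{-1}$. Put $S_L=\{a^{2l}\mid l\in L\}$ and assume $S_L=S_L^{-1}$. Then $\mathrm{Cay}(U_{6n},S)$ is integral if and only if all of the following hold for $0\le j\le 2n-1$ and $0\le k\le n-1$: (1) $S_L\in B(\langle a^2\rangle)$; (2) $\chi_j(S_2)$ is an integer; (3) $2\psi_k(S_2^2)$ is a perfect square (the square of an integer).
   Context: For an integer $n\ge1$, $U_{6n}=\langle a,b\mid a^{2n}=b^3=1,\ a^{-1}ba=b^{-1}\rangle$, a group of order $6n$ whose elements are uniquely $a^ib^\epsilon$ with $0\le i\le 2n-1$, $\epsilon\in\{0,1,2\}$. Let $\omega=\exp(\pi\imath/n)$. Its irreducible complex characters are: the $2n$ linear characters $\chi_j$ ($0\le j\le 2n-1$) given by $\chi_j(a^{2r}b^\epsilon)=\omega^{2jr}$ and $\chi_j(a^{2r+1}b^\epsilon)=\omega^{j(2r+1)}$ for all $\epsilon\in\{0,1,2\}$; and the $n$ degree-two characters $\psi_k$ ($0\le k\le n-1$) given by $\psi_k(a^{2r})=2\omega^{2kr}$, $\psi_k(a^{2r}b)=\psi_k(a^{2r}b^2)=-\omega^{2kr}$, $\psi_k(a^{2r+1}b^\epsilon)=0$. For a character $\chi$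 and a subset $A$, $\chi(A)=\sum_{x\in A}\chi(x)$ (with $\chi(\emptyset)=0$) and $\chi(A^2)=\sum_{x_1,x_2\in A}\chi(x_1x_2)$ over all ordered pairs. For a finite group $G$, the Boolean algebra $B(G)$ is the collection of subsets of $G$ obtainable from the subgroups of $G$ by finitely many unions, intersections and complements (in $G$). For a group $G$ and $S\subseteq G$ with $1\notin S=S^{-1}$, the Cayley graph $\mathrm{Cay}(G,S)$ has vertex set $G$ and edges $\{g,sg\}$ for $g\in G,s\in S$. A graph is integral if all eigenvalues of its adjacency matrix are integers. *)

theory Defs
  imports "HOL-Algebra.Group" "Jordan_Normal_Form.Char_Poly"
begin

text \<open>The group U_{6n}: the element a^i b^e (0 \<le> i < 2n, 0 \<le> e < 3) is the pair (i, e).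
  From b a = a b^{-1} we get (a^i b^e)(a^j b^f) = a^{i+j} b^{(-1)^j e + f}.\<close>

definition U :: "nat \<Rightarrow> (nat \<times> nat) monoid" where
  "U n = \<lparr> carrier = {0..<2*n} \<times> {0..<3},
           mult = (\<lambda>(i, e) (j, f). ((i + j) mod (2*n),
                                     (if even j then e + f else 2 * e + f) mod 3)),
           one = (0, 0) \<rparr>"

definition omega :: "nat \<Rightarrow> complex" where
  "omega n = exp (complex_of_real pi * \<i> / of_nat n)"

definition chi :: "nat \<Rightarrow> nat \<Rightarrow> nat \<times> nat \<Rightarrow> complex" where
  "chi n j x = (let i = fst x in
     if even i then omega n ^ (2 * j * (i div 2)) else omega n ^ (j * (2 * (i div 2) + 1)))"

definition psi :: "nat \<Rightarrow> nat \<Rightarrow> nat \<times> nat \<Rightarrow> complex" where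
  "psi n k x = (let i = fst x; e = snd x in
     if odd i then 0
     else if e = 0 then 2 * omega n ^ (2 * k * (i div 2))
     else - (omega n ^ (2 * k * (i div 2))))"

definition char_set :: "('a \<Rightarrow> complex) \<Rightarrow> 'a set \<Rightarrow> complex" where
  "char_set c A = (\<Sum>x\<in>A. c x)"

definition char_set_sq :: "('a, 'b) monoid_scheme \<Rightarrow> ('a \<Rightarrow> complex) \<Rightarrow> 'a set \<Rightarrow> complex" where
  "char_set_sq G c A = (\<Sum>x1\<in>A. \<Sum>x2\<in>A. c (x1 \<otimes>\<^bsub>G\<^esub> x2))"

inductive_set boolean_alg :: "('a, 'b) monoid_scheme \<Rightarrow> 'a set set" for G where
  subgrp: "subgroup H G \<Longrightarrow> H \<in> boolean_alg G"
| compl: "A \<in> boolean_alg G \<Longrightarrow> carrier G - A \<in> boolean_alg G"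
| union: "A \<in> boolean_alg G \<Longrightarrow> B \<in> boolean_alg G \<Longrightarrow> A \<union> B \<in> boolean_alg G"
| inter: "A \<in> boolean_alg G \<Longrightarrow> B \<in> boolean_alg G \<Longrightarrow> A \<inter> B \<in> boolean_alg G"

definition A2 :: "nat \<Rightarrow> (nat \<times> nat) set" where
  "A2 n = {(2 * r, 0) | r. r < n}"

definition U_A2 :: "nat \<Rightarrow> (nat \<times> nat) monoid" where
  "U_A2 n = (U n)\<lparr> carrier := A2 n \<rparr>"

text \<open>Cayley graph: vertex set G, edges {g, s g}; adjacency matrix w.r.t. an enumeration
  xs of the carrier (eigenvalues do not depend on the enumeration).\<close>
definition cayley_adj :: "('a, 'b) monoid_scheme \<Rightarrow> 'a set \<Rightarrow> 'a list \<Rightarrow> complex mat" where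
  "cayley_adj G S xs = mat (length xs) (length xs)
     (\<lambda>(p, q). if \<exists>s\<in>S. xs ! q = s \<otimes>\<^bsub>G\<^esub> (xs ! p) \<or> xs ! p = s \<otimes>\<^bsub>G\<^esub> (xs ! q)
               then 1 else 0)"

definition integral_matrix_spec :: "complex mat \<Rightarrow> bool" where
  "integral_matrix_spec M \<longleftrightarrow> (\<forall>ev. eigenvalue M ev \<longrightarrow> ev \<in> \<int>)"

definition U_list :: "nat \<Rightarrow> (nat \<times> nat) list" where
  "U_list n = [(i, e). i \<leftarrow> [0..<2*n], e \<leftarrow> [0..<3]]"

definition integral_cayley_U :: "nat \<Rightarrow> (nat \<times> nat) set \<Rightarrow> bool" where
  "integral_cayley_U n S \<longleftrightarrow> integral_matrix_spec (cayley_adj (U n) S (U_list n))"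

end

theory Submission
  imports Defs "HOL-Number_Theory.Number_Theory" "HOL-Library.Indicator_Function"
begin

text \<open>
  The adjacency operator acts on the span of the functions \<open>a\<^sup>i b\<^sup>e \<mapsto> w\<^sup>i z\<^sup>e\<close>, supported on
  all \<open>i\<close> of a fixed parity, by \<open>2 \<times> 2\<close> blocks. With \<open>\<sigma>(w) = \<Sum>\<^bsub>l\<in>L\<^esub> w\<^bsup>2l\<^esup>\<close>, the spectrum
  consists of the numbers \<open>2 \<sigma>(w) + \<chi>(S\<^sub>2)\<close> and the roots of \<open>(X + \<sigma>(w))\<^sup>2 = \<psi>(S\<^sub>2\<^sup>2) / 2\<close>.
  Changing the sign of the root shows that integrality forces \<open>2 \<sigma>(w)\<close>, \<open>\<chi>(S\<^sub>2)\<close> and the square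
  root of \<open>2 \<psi>(S\<^sub>2\<^sup>2)\<close> to be integers; conversely the three conditions make every eigenvalue
  rational, hence integral, as a root of a monic integer polynomial.

  It remains to see that a subset of the cyclic group of order \<open>n\<close> lies in the Boolean algebra
  iff all its character sums are rational. Indicators of members of the Boolean algebra are
  integer combinations of indicators of subgroups. Conversely, if the character sums are
  rational, they are integers bounded by \<open>n\<close>, and Frobenius modulo a prime \<open>p > 2n\<close> shows that
  they are invariant under \<open>z \<mapsto> z\<^sup>p\<close>. By the Chinese remainder theorem, any two elements of the
  same order are related by a multiplier with only such prime factors, so by injectivity of the
  discrete Fourier transform the set is a union of classes of elements of equal order.
\<close>

subsection \<open>Integrality of rational values at roots of unity\<close>

text \<open>The characteristic polynomial is monic with integer coefficients, so every eigenvalue is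
  an algebraic integer, and a rational algebraic integer is an integer.\<close>

lemma rational_eigenvalue_int_matrix:
  fixes ev :: complex
  assumes M: "M \<in> carrier_mat m m" and ints: "\<And>i j. i < m \<Longrightarrow> j < m \<Longrightarrow> M $$ (i, j) \<in> \<int>"
    and ev: "eigenvalue M ev" and rat: "ev \<in> \<rat>"
  shows "ev \<in> \<int>"
proof -
  define N :: "int mat" where "N = map_mat (\<lambda>z. \<lfloor>Re z\<rfloor>) M"
  have N: "N \<in> carrier_mat m m" using M by (auto simp: N_def)
  have MN: "M = map_mat of_int N"
  proof (rule eq_matI)
    fix i j assume "i < dim_row (map_mat complex_of_int N)" "j < dim_col (map_mat complex_of_int N)"
    then have ij: "i < m" "j < m" using N by auto
    obtain a where "M $$ (i, j) = of_int a" using ints[OF ij] by (auto elim: Ints_cases)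
    then show "M $$ (i, j) = map_mat complex_of_int N $$ (i, j)"
      using ij M by (simp add: N_def)
  qed (use M N in auto)
  have "poly (char_poly M) ev = 0"
    using eigenvalue_root_char_poly[OF M] ev by simp
  then have "poly (map_poly of_int (char_poly N)) ev = 0"
    unfolding MN of_int_hom.char_poly_hom[OF N] .
  moreover have "lead_coeff (char_poly N) = 1"
    using degree_monic_char_poly[OF N] by simp
  ultimately have "algebraic_int ev"
    by (auto simp: algebraic_int_altdef_ipoly)
  then show ?thesis using rat by (rule rational_algebraic_int_is_int)
qed

lemma power_mod_root_of_unity:
  fixes z :: "'a::monoid_mult"
  assumes "z ^ n = 1"
  shows "z ^ (k mod n) = z ^ k"
  by (metis assms div_mult_mod_eq mult.commute mult_1_left power_add power_mult power_one)

text \<open>Multiplication by P(z) acts on the powers 1, z, ..., z^(n-1) through an integer matrix,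
  so P(z) is an eigenvalue of that matrix and the previous criterion applies.\<close>

lemma rational_poly_root_of_unity:
  fixes z :: complex
  assumes n: "n > 0" and z: "z ^ n = 1" and rat: "poly (map_poly of_int P) z \<in> \<rat>"
  shows "poly (map_poly of_int P) z \<in> \<int>"
proof -
  \<comment> \<open>Row \<open>i\<close> writes z^i P(z) as a combination of the z^q with q < n,
    exponents being reduced by z^n = 1.\<close>
  define c where "c = (\<lambda>i q. \<Sum>j\<le>degree P. if (i + j) mod n = q then Polynomial.coeff P j else 0)"
  define M :: "complex mat" where "M = mat n n (\<lambda>(i, q). of_int (c i q))"
  define v where "v = vec n (\<lambda>i. z ^ i)"
  have M: "M \<in> carrier_mat n n" by (simp add: M_def)
  have pol: "poly (map_poly of_int P) z = (\<Sum>j\<le>degree P. of_int (Polynomial.coeff P j) * z ^ j)"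
    by (simp add: poly_altdef coeff_map_poly degree_map_poly)
  have "M *\<^sub>v v = poly (map_poly of_int P) z \<cdot>\<^sub>v v"
  proof (rule eq_vecI)
    fix i assume "i < dim_vec (poly (map_poly of_int P) z \<cdot>\<^sub>v v)"
    then have i: "i < n" by (simp add: v_def)
    have "(M *\<^sub>v v) $ i = (\<Sum>q<n. of_int (c i q) * z ^ q)"
      using i by (simp add: M_def v_def scalar_prod_def lessThan_atLeast0)
    also have "\<dots> = (\<Sum>q<n. \<Sum>j\<le>degree P. if (i + j) mod n = q then of_int (Polynomial.coeff P j) * z ^ q else 0)"
      by (auto simp: c_def sum_distrib_right intro!: sum.cong)
    also have "\<dots> = (\<Sum>j\<le>degree P. \<Sum>q<n. if (i + j) mod n = q then of_int (Polynomial.coeff P j) * z ^ q else 0)"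
      by (rule sum.swap)
    also have "\<dots> = (\<Sum>j\<le>degree P. of_int (Polynomial.coeff P j) * z ^ (i + j))"
      using n by (intro sum.cong refl) (simp add: power_mod_root_of_unity[OF z])
    also have "\<dots> = poly (map_poly of_int P) z * z ^ i"
      unfolding pol sum_distrib_right by (simp add: power_add mult_ac)
    finally show "(M *\<^sub>v v) $ i = (poly (map_poly of_int P) z \<cdot>\<^sub>v v) $ i"
      using i by (simp add: v_def)
  qed (simp add: M_def v_def)
  moreover have "v \<noteq> 0\<^sub>v n"
  proof
    assume "v = 0\<^sub>v n"
    then have "v $ 0 = 0" using n by simp
    then show False using n by (simp add: v_def)
  qed
  ultimately have "eigenvalue M (poly (map_poly of_int P) z)"
    unfolding eigenvalue_def eigenvector_def by (intro exI[of _ v]) (simp add: M_def v_def)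
  then show ?thesis
    by (intro rational_eigenvalue_int_matrix[OF M _ _ rat]) (auto simp: M_def)
qed

text \<open>The difference of the two sides is a polynomial of degree below n that vanishes at all n
  roots of unity, hence is zero.\<close>

lemma dft_injective:
  fixes f g :: "nat \<Rightarrow> complex"
  assumes eq: "\<And>z. z ^ n = 1 \<Longrightarrow> (\<Sum>i<n. f i * z ^ i) = (\<Sum>i<n. g i * z ^ i)" and i: "i < n"
  shows "f i = g i"
proof -
  define p where "p = (\<Sum>i<n. Polynomial.monom (f i - g i) i)"
  have cf: "Polynomial.coeff p k = (if k < n then f k - g k else 0)" for k
    by (simp add: p_def coeff_sum)
  have "p = 0"
  proof (rule ccontr)
    assume p0: "p \<noteq> 0"
    have "{z. z ^ n = 1} \<subseteq> {z. poly p z = 0}"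
      using eq by (auto simp: p_def poly_sum poly_monom left_diff_distrib sum_subtractf)
    then have "card {z::complex. z ^ n = 1} \<le> card {z. poly p z = 0}"
      by (rule card_mono[OF poly_roots_finite[OF p0]])
    then have "n \<le> card {z. poly p z = 0}"
      using i by (simp add: card_roots_unity_eq)
    also have "\<dots> \<le> degree p" by (rule card_poly_roots_bound[OF p0])
    also have "\<dots> < n" using i by (intro degree_lessI) (auto simp: cf)
    finally show False by simp
  qed
  then show ?thesis using cf[of i] i by simp
qed

section \<open>Frobenius congruences in the ring Z[z]\<close>

text \<open>The ring Z[z], given as a range so that membership yields the polynomial required by
  \<open>rational_poly_root_of_unity\<close>.\<close>

definition int_polys_at :: "complex \<Rightarrow> complex set" where
  "int_polys_at z = range (\<lambda>P. poly (map_poly of_int P) z)"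

lemma int_polys_at_add: "x \<in> int_polys_at z \<Longrightarrow> y \<in> int_polys_at z \<Longrightarrow> x + y \<in> int_polys_at z"
  unfolding int_polys_at_def by (auto simp: image_iff simp flip: poly_add of_int_poly_hom.hom_add)

lemma int_polys_at_mult: "x \<in> int_polys_at z \<Longrightarrow> y \<in> int_polys_at z \<Longrightarrow> x * y \<in> int_polys_at z"
  unfolding int_polys_at_def by (auto simp: image_iff simp flip: poly_mult of_int_poly_hom.hom_mult)

lemma int_polys_at_of_nat: "of_nat k \<in> int_polys_at z"
  unfolding int_polys_at_def by (rule range_eqI[of _ _ "[:int k:]"]) (cases "k = 0"; simp)

lemma int_polys_at_self: "z \<in> int_polys_at z"
  unfolding int_polys_at_def by (rule range_eqI[of _ _ "[:0, 1:]"]) simp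

lemma int_polys_at_power: "x \<in> int_polys_at z \<Longrightarrow> x ^ k \<in> int_polys_at z"
  using int_polys_at_of_nat[of 1 z] by (induction k) (auto intro: int_polys_at_mult)

lemma int_polys_at_sum: "(\<And>i. i \<in> I \<Longrightarrow> f i \<in> int_polys_at z) \<Longrightarrow> sum f I \<in> int_polys_at z"
  using int_polys_at_of_nat[of 0 z]
  by (induction I rule: infinite_finite_induct) (auto intro: int_polys_at_add)

text \<open>A prime divides its inner binomial coefficients. Keeping the quotient \<open>b\<close>
  in Z[z] matters: once \<open>b\<close> is known to be rational, it is an integer.\<close>

lemma frobenius_add:
  assumes p: "prime p" and x: "x \<in> int_polys_at z" and y: "y \<in> int_polys_at z"
  shows "\<exists>b\<in>int_polys_at z. (x + y) ^ p = x ^ p + y ^ p + of_nat p * b"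
proof -
  have p1: "p > 1" using p by (rule prime_gt_1_nat)
  define b where "b = (\<Sum>k\<in>{0<..<p}. of_nat ((p choose k) div p) * (x ^ k * y ^ (p - k)))"
  have "b \<in> int_polys_at z"
    unfolding b_def
    by (intro int_polys_at_sum int_polys_at_mult int_polys_at_power int_polys_at_of_nat x y)
  moreover have "(x + y) ^ p = x ^ p + y ^ p + of_nat p * b"
  proof -
    have split: "{..p} = insert 0 (insert p {0<..<p})" using p1 by auto
    have ch: "of_nat (p choose k) = (of_nat p * of_nat ((p choose k) div p) :: complex)"
      if "k \<in> {0<..<p}" for k
      using dvd_choose_prime[of k p] that p
      by (simp del: of_nat_mult flip: of_nat_mult)
    have "(x + y) ^ p = (\<Sum>k\<le>p. of_nat (p choose k) * x ^ k * y ^ (p - k))"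
      by (rule binomial_ring)
    also have "\<dots> = x ^ p + y ^ p + (\<Sum>k\<in>{0<..<p}. of_nat (p choose k) * x ^ k * y ^ (p - k))"
      using p1 by (simp add: split)
    also have "(\<Sum>k\<in>{0<..<p}. of_nat (p choose k) * x ^ k * y ^ (p - k)) = of_nat p * b"
      unfolding b_def sum_distrib_left by (intro sum.cong refl) (simp add: ch mult_ac)
    finally show ?thesis .
  qed
  ultimately show ?thesis by blast
qed

lemma frobenius_sum:
  assumes p: "prime p" and fin: "finite I" and f: "\<And>i. i \<in> I \<Longrightarrow> f i \<in> int_polys_at z"
  shows "\<exists>b\<in>int_polys_at z. (\<Sum>i\<in>I. f i) ^ p = (\<Sum>i\<in>I. f i ^ p) + of_nat p * b"
  using fin f
proof (induction I)
  case empty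
  then show ?case using int_polys_at_of_nat[of 0 z] prime_gt_0_nat[OF p]
    by (intro bexI[of _ 0]) (auto simp: power_0_left)
next
  case (insert i I)
  then obtain b where b: "b \<in> int_polys_at z" "(\<Sum>i\<in>I. f i) ^ p = (\<Sum>i\<in>I. f i ^ p) + of_nat p * b"
    by auto
  obtain c where c: "c \<in> int_polys_at z"
    "(f i + (\<Sum>i\<in>I. f i)) ^ p = f i ^ p + (\<Sum>i\<in>I. f i) ^ p + of_nat p * c"
    using frobenius_add[OF p, of "f i" z "\<Sum>i\<in>I. f i"] insert.prems int_polys_at_sum[of I f z] by auto
  show ?case
    using insert.hyps b c
    by (intro bexI[of _ "b + c"]) (auto simp: algebra_simps intro: int_polys_at_add)
qed

lemma fermat_int:
  fixes a :: int
  assumes p: "prime p"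
  shows "int p dvd a ^ p - a"
proof -
  define b where "b = nat (a mod int p)"
  have p0: "p > 0" using p by (rule prime_gt_0_nat)
  have ab: "[a = int b] (mod int p)" using p0 by (simp add: b_def cong_def)
  have "[b ^ p = b] (mod p)"
  proof (cases "p dvd b")
    case True
    then have "p dvd b ^ p" using p0 by (simp add: dvd_power_same prime_dvd_power_iff p)
    with True show ?thesis by (simp add: cong_def mod_eq_0_iff_dvd)
  next
    case False
    have "[b ^ (p - 1) * b = 1 * b] (mod p)"
      by (intro cong_mult fermat_theorem p False cong_refl)
    then show ?thesis using p0 by (simp flip: power_Suc2)
  qed
  then have "[int b ^ p = int b] (mod int p)"
    by (metis cong_int_iff of_nat_power)
  then have "[a ^ p = a] (mod int p)"
    using ab by (meson cong_pow cong_sym cong_trans)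
  then show ?thesis by (simp add: cong_iff_dvd_diff)
qed

text \<open>Modulo a prime \<open>p\<close>, raising to the \<open>p\<close>-th power is both the identity on the integer
  value at \<open>z\<close> and the substitution \<open>z \<mapsto> z ^ p\<close>; for large \<open>p\<close> the congruence is an equality.
  This replaces the irreducibility of cyclotomic polynomials.\<close>

lemma rational_char_sum_large_prime:
  fixes z :: complex
  assumes n: "n > 0" and z: "z ^ n = 1" and L: "L \<subseteq> {0..<n}"
    and rat: "\<And>z::complex. z ^ n = 1 \<Longrightarrow> (\<Sum>l\<in>L. z ^ l) \<in> \<rat>"
    and p: "prime p" "p > 2 * n"
  shows "(\<Sum>l\<in>L. (z ^ p) ^ l) = (\<Sum>l\<in>L. z ^ l)"
proof -
  have fin: "finite L" using L finite_subset by blast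
  have mem: "(\<Sum>l\<in>L. y ^ l) \<in> int_polys_at y" for y
    by (intro int_polys_at_sum int_polys_at_power int_polys_at_self)
  \<comment> \<open>The bound holds because the sum has at most n terms, each of modulus 1.\<close>
  have int_val: "\<exists>a. (\<Sum>l\<in>L. y ^ l) = of_int a \<and> \<bar>a\<bar> \<le> int n" if y: "y ^ n = 1" for y :: complex
  proof -
    obtain P where "(\<Sum>l\<in>L. y ^ l) = poly (map_poly of_int P) y"
      using mem[of y] by (auto simp: int_polys_at_def)
    then have "(\<Sum>l\<in>L. y ^ l) \<in> \<int>"
      using rational_poly_root_of_unity[OF n y, of P] rat[OF y] by simp
    then obtain a where a: "(\<Sum>l\<in>L. y ^ l) = of_int a" by (auto elim: Ints_cases)
    have "norm y = 1" using y n by (metis power_eq_1_iff less_numeral_extra(3))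
    then have "norm (\<Sum>l\<in>L. y ^ l) \<le> (\<Sum>l\<in>L. 1)"
      by (intro sum_norm_le) (simp add: norm_power)
    also have "\<dots> \<le> real n" using card_mono[OF _ L] by simp
    finally have "\<bar>real_of_int a\<bar> \<le> real n" by (simp add: a)
    then have "\<bar>a\<bar> \<le> int n" by linarith
    with a show ?thesis by blast
  qed
  obtain a where a: "(\<Sum>l\<in>L. z ^ l) = of_int a" "\<bar>a\<bar> \<le> int n" using int_val[OF z] by blast
  have zp: "(z ^ p) ^ n = 1" by (metis power_mult power_one z mult.commute)
  obtain c where c: "(\<Sum>l\<in>L. (z ^ p) ^ l) = of_int c" "\<bar>c\<bar> \<le> int n" using int_val[OF zp] by blast
  obtain b where b: "b \<in> int_polys_at z"
    "(\<Sum>l\<in>L. z ^ l) ^ p = (\<Sum>l\<in>L. (z ^ l) ^ p) + of_nat p * b"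
    using frobenius_sum[OF p(1) fin, of "\<lambda>l. z ^ l" z] int_polys_at_power[OF int_polys_at_self] by blast
  have pb: "of_int a ^ p = of_int c + of_nat p * b"
    using b(2) a(1) c(1) by (simp flip: power_mult add: mult.commute)
  have p0: "(of_nat p :: complex) \<noteq> 0" using p by auto
  \<comment> \<open>Solving for \<open>b\<close> exhibits it as rational; lying in Z[z], it is then
    an integer, and the relation becomes a congruence modulo p between integers.\<close>
  have "b = (of_int (a ^ p - c)) / of_nat p" using pb p0 by (simp add: field_simps)
  then have "b \<in> \<rat>" by simp
  with b(1) have "b \<in> \<int>"
    using rational_poly_root_of_unity[OF n z] by (auto simp: int_polys_at_def)
  then obtain d where d: "b = of_int d" by (auto elim: Ints_cases)
  have "(of_int (a ^ p) :: complex) = of_int (c + int p * d)"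
    using pb d by simp
  then have "a ^ p = c + int p * d" unfolding of_int_eq_iff .
  then have "int p dvd a ^ p - c" by simp
  with fermat_int[OF p(1), of a] have "int p dvd (a ^ p - c) - (a ^ p - a)" by (rule dvd_diff[rotated])
  then have "int p dvd a - c" by simp
  \<comment> \<open>Both values are at most n in modulus, so p > 2n turns the congruence into an
    equality.\<close>
  moreover have "\<bar>a - c\<bar> < int p" using a(2) c(2) p(2) by linarith
  ultimately have "a = c" using dvd_imp_le_int[of "a - c" "int p"] by auto
  then show ?thesis using a c by simp
qed

section \<open>Multipliers and classes of exponents with equal gcd\<close>

text \<open>The prime factors of \<open>u\<close> are peeled off one at a time; since z^p is again
  an n-th root of unity, the induction hypothesis applies to it with the cofactor.\<close>

lemma rational_char_sum_large_factors:
  fixes z :: complex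
  assumes n: "n > 0" and L: "L \<subseteq> {0..<n}"
    and rat: "\<And>z::complex. z ^ n = 1 \<Longrightarrow> (\<Sum>l\<in>L. z ^ l) \<in> \<rat>"
    and u: "u > 0" "\<And>p. prime p \<Longrightarrow> p dvd u \<Longrightarrow> p > 2 * n"
    and z: "z ^ n = 1"
  shows "(\<Sum>l\<in>L. (z ^ u) ^ l) = (\<Sum>l\<in>L. z ^ l)"
  using u z
proof (induction u arbitrary: z rule: less_induct)
  case (less u)
  show ?case
  proof (cases "u = 1")
    case False
    then obtain p v where p: "prime p" and v: "u = p * v"
      using prime_factor_nat[of u] by (auto simp: dvd_def)
    have "v < u" "v > 0" using v less.prems(1) prime_gt_1_nat[OF p] by auto
    then have IH: "(\<Sum>l\<in>L. ((z ^ p) ^ v) ^ l) = (\<Sum>l\<in>L. (z ^ p) ^ l)"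
      using less.prems v by (intro less.IH) (auto simp flip: power_mult simp: mult.commute, metis power_mult power_one)
    also have "\<dots> = (\<Sum>l\<in>L. z ^ l)"
      using less.prems v p by (intro rational_char_sum_large_prime[OF n _ L rat p]) auto
    finally show ?thesis by (simp add: v power_mult)
  qed simp
qed

text \<open>After division by the common gcd, both exponents are units modulo m = n/d, which fixes
  \<open>u\<close> modulo m as a unit. The Chinese remainder theorem then keeps the remaining small
  primes away from \<open>u\<close>.\<close>

lemma exists_multiplier_large_factors:
  fixes l l' n B :: nat
  assumes n: "n > 0" and g: "gcd l n = gcd l' n"
  shows "\<exists>u>0. [l * u = l'] (mod n) \<and> (\<forall>p. prime p \<longrightarrow> p dvd u \<longrightarrow> p > B)"
proof -
  define d where "d = gcd l n"
  have d0: "d > 0" using n by (simp add: d_def)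
  have "d dvd l" "d dvd n" by (simp_all add: d_def)
  moreover have "d dvd l'" by (simp add: d_def g)
  ultimately obtain a a' m where a: "l = d * a" and a': "l' = d * a'" and m: "n = d * m"
    by (auto simp: dvd_def)
  have "d * gcd a m = gcd l n" unfolding a m by (rule gcd_mult_distrib_nat)
  then have "d * gcd a m = d" by (simp add: d_def)
  then have "gcd a m = 1" using d0 by (metis mult_cancel_left mult_1_right less_numeral_extra(3))
  then have ca: "coprime a m" by (rule gcd_eq_1_imp_coprime)
  have "d * gcd a' m = gcd l' n" unfolding a' m by (rule gcd_mult_distrib_nat)
  then have "d * gcd a' m = d" by (simp add: d_def g)
  then have "gcd a' m = 1" using d0 by (metis mult_cancel_left mult_1_right less_numeral_extra(3))
  then have ca': "coprime a' m" by (rule gcd_eq_1_imp_coprime)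
  \<comment> \<open>The primes to be avoided that do not divide m; the condition u = 1 modulo
    \<open>Q\<close> excludes them. Primes dividing m are excluded because a' is coprime to
    m.\<close>
  define Q where "Q = \<Prod>{q. prime q \<and> q \<le> B \<and> \<not> q dvd m}"
  have fin: "finite {q. prime q \<and> q \<le> B \<and> \<not> q dvd m}" by simp
  have cQ: "coprime m Q"
    unfolding Q_def by (intro prod_coprime_right) (auto simp: coprime_commute prime_imp_coprime)
  obtain b where b: "[a * b = 1] (mod m)" using cong_solve_coprime_nat[OF ca] by auto
  obtain u0 where u0: "[u0 = b * a'] (mod m)" "[u0 = 1] (mod Q)"
    using binary_chinese_remainder_nat[OF cQ] by blast
  \<comment> \<open>Adding \<open>m * Q\<close> preserves both congruences and makes
    \<open>u\<close> positive.\<close>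
  define u where "u = u0 + m * Q"
  have Q0: "Q > 0" unfolding Q_def by (intro prod_pos) (auto simp: prime_gt_0_nat)
  have m0: "m > 0" using n m by auto
  have u1: "[u = b * a'] (mod m)" "[u = 1] (mod Q)"
    using u0 by (simp_all add: u_def cong_def)
  have au: "[a * u = a'] (mod m)"
  proof -
    have "[a * u = a * (b * a')] (mod m)" by (intro cong_mult cong_refl u1)
    also have "a * (b * a') = (a * b) * a'" by simp
    also have "[(a * b) * a' = 1 * a'] (mod m)" by (intro cong_mult cong_refl b)
    finally show ?thesis by simp
  qed
  have "[l * u = l'] (mod n)"
    using au d0 unfolding a a' m by (simp add: cong_def mult.assoc mod_mult_mult1)
  moreover have "p > B" if p: "prime p" "p dvd u" for p
  proof (rule ccontr)
    assume "\<not> p > B"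
    show False
    proof (cases "p dvd m")
      case True
      have "p dvd a * u" using p by simp
      then have "p dvd a'" using au True by (meson cong_dvd_iff cong_dvd_modulus_nat)
      with True have "is_unit p" by (intro coprime_common_divisor[OF ca'])
      with p(1) show False by simp
    next
      case False
      then have "p dvd Q" unfolding Q_def using p \<open>\<not> p > B\<close> fin by (intro dvd_prodI) auto
      then have "p dvd 1" using u1(2) p(2) by (meson cong_dvd_iff cong_dvd_modulus_nat)
      with p(1) show False by simp
    qed
  qed
  moreover have "u > 0" using Q0 m0 by (simp add: u_def)
  ultimately show ?thesis by blast
qed

text \<open>Multiplying the exponents in \<open>L\<close> by a suitable \<open>u\<close> changes no
  character sum, so Fourier inversion shows that \<open>L\<close> is mapped to itself modulo n,
  while l goes to l'.\<close>

lemma rational_char_sums_imp_gcd_closed: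
  assumes n: "n > 0" and L: "L \<subseteq> {0..<n}"
    and rat: "\<And>z::complex. z ^ n = 1 \<Longrightarrow> (\<Sum>l\<in>L. z ^ l) \<in> \<rat>"
    and l: "l \<in> L" and l': "l' < n" and g: "gcd l n = gcd l' n"
  shows "l' \<in> L"
proof -
  obtain u where u: "u > 0" "[l * u = l'] (mod n)" "\<And>p. prime p \<Longrightarrow> p dvd u \<Longrightarrow> p > 2 * n"
    using exists_multiplier_large_factors[OF n g, of "2 * n"] by blast
  have fin: "finite L" using L finite_subset by blast
  \<comment> \<open>\<open>f i\<close> counts the k in \<open>L\<close> with k u = i modulo n, and
    \<open>e\<close> is the indicator of \<open>L\<close>; the two have the same Fourier
    transform.\<close>
  define f where "f = (\<lambda>i. \<Sum>k\<in>L. if k * u mod n = i then 1 else (0::complex))"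
  define e where "e = (\<lambda>i. if i \<in> L then 1 else (0::complex))"
  have "f l' = e l'"
  proof (rule dft_injective[OF _ l'])
    fix z :: complex assume z: "z ^ n = 1"
    have "(\<Sum>i<n. f i * z ^ i) = (\<Sum>i<n. \<Sum>k\<in>L. if k * u mod n = i then z ^ i else 0)"
      by (auto simp: f_def sum_distrib_right intro!: sum.cong)
    also have "\<dots> = (\<Sum>k\<in>L. \<Sum>i<n. if k * u mod n = i then z ^ i else 0)" by (rule sum.swap)
    also have "\<dots> = (\<Sum>k\<in>L. (z ^ u) ^ k)"
      using n by (intro sum.cong refl) (simp add: power_mod_root_of_unity[OF z] power_mult[symmetric] mult.commute)
    also have "\<dots> = (\<Sum>l\<in>L. z ^ l)"
      by (rule rational_char_sum_large_factors[OF n L rat u(1,3) z])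
    also have "\<dots> = (\<Sum>i<n. e i * z ^ i)"
      unfolding e_def using L by (intro sum.mono_neutral_cong_left) auto
    finally show "(\<Sum>i<n. f i * z ^ i) = (\<Sum>i<n. e i * z ^ i)" .
  qed
  moreover have "f l' \<noteq> 0"
  proof -
    have "l * u mod n = l'" using u(2) l' by (simp add: cong_def)
    then have "l \<in> {k \<in> L. k * u mod n = l'}" using l by simp
    then have "card {k \<in> L. k * u mod n = l'} \<noteq> 0" using fin by (subst card_0_eq) auto
    moreover have "f l' = of_nat (card {k \<in> L. k * u mod n = l'})"
      using fin by (simp add: f_def sum.If_cases Int_def)
    ultimately show ?thesis by simp
  qed
  ultimately show ?thesis by (auto simp: e_def split: if_splits)
qed

subsection \<open>Boolean algebras of finite groups\<close>

lemma (in group) sum_translate: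
  assumes H: "subgroup H G" and h: "h \<in> H"
  shows "(\<Sum>x\<in>H. f (h \<otimes> x)) = sum f H"
proof (rule sum.reindex_bij_betw)
  have sub: "H \<subseteq> carrier G" by (rule subgroup.subset[OF H])
  show "bij_betw (\<lambda>x. h \<otimes> x) H H"
  proof (rule bij_betw_byWitness[where f' = "\<lambda>x. inv h \<otimes> x"])
    show "\<forall>x\<in>H. inv h \<otimes> (h \<otimes> x) = x" "\<forall>x\<in>H. h \<otimes> (inv h \<otimes> x) = x"
      using sub h by (auto simp: subset_iff m_assoc[symmetric])
  qed (use H h in \<open>auto intro: subgroup.m_closed subgroup.m_inv_closed\<close>)
qed

text \<open>Orthogonality: if \<open>c\<close> is not constantly 1 on \<open>H\<close>, translation
  multiplies the sum by some factor other than 1 and leaves it unchanged, so it vanishes; otherwise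
  the sum is the cardinality of \<open>H\<close>.\<close>

lemma (in group) char_sum_subgroup_rational:
  fixes c :: "'a \<Rightarrow> complex"
  assumes H: "subgroup H G" and c: "\<And>x y. x \<in> H \<Longrightarrow> y \<in> H \<Longrightarrow> c (x \<otimes> y) = c x * c y"
  shows "sum c H \<in> \<rat>"
proof (cases "\<forall>h\<in>H. c h = 1")
  case False
  then obtain h where h: "h \<in> H" "c h \<noteq> 1" by blast
  have "sum c H = (\<Sum>x\<in>H. c (h \<otimes> x))" by (rule sum_translate[OF H h(1), symmetric])
  also have "\<dots> = c h * sum c H" unfolding sum_distrib_left by (intro sum.cong refl c h)
  finally have "sum c H = 0" using h(2) by simp
  then show ?thesis by simp
qed simp

inductive_set subgroup_span :: "('a, 'b) monoid_scheme \<Rightarrow> ('a \<Rightarrow> int) set" for G where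
  indicat: "subgroup H G \<Longrightarrow> indicator H \<in> subgroup_span G"
| add: "f \<in> subgroup_span G \<Longrightarrow> g \<in> subgroup_span G \<Longrightarrow> (\<lambda>x. f x + g x) \<in> subgroup_span G"
| minus: "f \<in> subgroup_span G \<Longrightarrow> (\<lambda>x. - f x) \<in> subgroup_span G"

text \<open>Indicators of subgroups multiply to the indicator of the intersection, again a subgroup,
  so their integer span is closed under products.\<close>

lemma (in group) subgroup_span_mult:
  assumes "f \<in> subgroup_span G" "g \<in> subgroup_span G"
  shows "(\<lambda>x. f x * g x) \<in> subgroup_span G"
  using assms(1)
proof induction
  case (indicat H)
  show ?case using assms(2)
  proof induction
    case (indicat K)
    have "(\<lambda>x::'a. indicator H x * indicator K x :: int) = indicator (H \<inter> K)"
      by (auto simp: indicator_def fun_eq_iff)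
    then show ?case
      using subgroup_span.indicat[OF subgroups_Inter_pair[OF \<open>subgroup H G\<close> indicat]] by simp
  qed (auto simp: distrib_left dest: subgroup_span.add subgroup_span.minus)
qed (auto simp: distrib_right dest: subgroup_span.add subgroup_span.minus)

text \<open>Complement, union and intersection become subtraction from the indicator of the group,
  inclusion-exclusion and product. Containment in the carrier is carried along for the complement
  case.\<close>

lemma (in group) boolean_alg_indicator:
  assumes "A \<in> boolean_alg G"
  shows "A \<subseteq> carrier G \<and> indicator A \<in> subgroup_span G"
  using assms
proof induction
  case (subgrp H)
  then show ?case by (simp add: subgroup.subset subgroup_span.indicat)
next
  case (compl A)
  have "indicator (carrier G - A) = (\<lambda>x. indicator (carrier G) x + - indicator A x :: int)"
    using compl by (auto simp: fun_eq_iff indicator_def)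
  also have "\<dots> \<in> subgroup_span G"
    using compl subgroup_span.add[OF subgroup_span.indicat[OF subgroup_self] subgroup_span.minus]
    by blast
  finally show ?case by auto
next
  case (union A B)
  have "indicator (A \<union> B) = (\<lambda>x. (indicator A x + indicator B x) + - (indicator A x * indicator B x) :: int)"
    by (auto simp: fun_eq_iff indicator_def)
  also have "\<dots> \<in> subgroup_span G"
    using union by (intro subgroup_span.add subgroup_span.minus subgroup_span_mult) auto
  finally show ?case using union by auto
next
  case (inter A B)
  have "indicator (A \<inter> B) = (\<lambda>x. indicator A x * indicator B x :: int)"
    by (auto simp: fun_eq_iff indicator_def)
  also have "\<dots> \<in> subgroup_span G"
    using inter by (intro subgroup_span_mult) auto
  finally show ?case using inter by auto
qed

lemma (in group) char_sum_boolean_alg_rational: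
  fixes c :: "'a \<Rightarrow> complex"
  assumes fin: "finite (carrier G)" and A: "A \<in> boolean_alg G"
    and c: "\<And>x y. x \<in> carrier G \<Longrightarrow> y \<in> carrier G \<Longrightarrow> c (x \<otimes> y) = c x * c y"
  shows "sum c A \<in> \<rat>"
proof -
  have restr: "(\<Sum>x\<in>carrier G. of_int (indicator B x) * c x) = sum c B" if "B \<subseteq> carrier G" for B
    using that fin by (intro sum.mono_neutral_cong_right) (auto simp: indicator_def)
  have span: "(\<Sum>x\<in>carrier G. of_int (f x) * c x) \<in> \<rat>" if "f \<in> subgroup_span G" for f
    using that
  proof induction
    case (indicat H)
    then show ?case
      using char_sum_subgroup_rational[OF indicat, of c] c subgroup.subset[OF indicat]
      by (simp add: restr subset_iff)
  qed (auto simp: distrib_right sum.distrib sum_negf)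
  show ?thesis
    using boolean_alg_indicator[OF A] span restr by metis
qed

lemma boolean_alg_empty: "group G \<Longrightarrow> {} \<in> boolean_alg G"
  using boolean_alg.compl[OF boolean_alg.subgrp[OF group.subgroup_self]] by fastforce

lemma boolean_alg_UN:
  assumes "group G" "finite I" "\<And>i. i \<in> I \<Longrightarrow> A i \<in> boolean_alg G"
  shows "(\<Union>i\<in>I. A i) \<in> boolean_alg G"
  using assms(2,3)
  by (induction I) (auto intro: boolean_alg.union boolean_alg_empty[OF assms(1)])

subsection \<open>The group \<open>U n\<close> and its cyclic subgroup \<open>A2 n\<close>\<close>

lemma carrier_U [simp]: "carrier (U n) = {0..<2*n} \<times> {0..<3}"
  and one_U [simp]: "\<one>\<^bsub>U n\<^esub> = (0, 0)"
  and mult_U [simp]: "(i, e) \<otimes>\<^bsub>U n\<^esub> (j, f) =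
    ((i + j) mod (2 * n), (if even j then e + f else 2 * e + f) mod 3)"
  by (simp_all add: U_def)

lemma even_mod_double [simp]: "even (a mod (2 * n)) \<longleftrightarrow> even (a::nat)"
  by (simp add: dvd_mod_iff)

lemma group_U:
  assumes n: "n \<ge> 1"
  shows "group (U n)"
proof (rule groupI)
  fix x y z assume xyz: "x \<in> carrier (U n)" "y \<in> carrier (U n)" "z \<in> carrier (U n)"
  obtain i e j f k g where eqs: "x = (i, e)" "y = (j, f)" "z = (k, g)"
    by (metis surj_pair)
  have "((i + j) mod (2 * n) + k) mod (2 * n) = (i + (j + k) mod (2 * n)) mod (2 * n)"
    by (simp only: mod_add_left_eq mod_add_right_eq add.assoc)
  moreover have dbl: "(2 * (a mod 3) + b) mod 3 = (2 * a + b) mod 3" for a b :: nat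
    by (metis mod_add_left_eq mod_mult_right_eq)
  moreover have "(2 * ((e + f) mod 3) + g) mod 3 = (2 * e + (2 * f + g) mod 3) mod 3"
    unfolding dbl mod_add_right_eq by (simp add: algebra_simps)
  moreover have "((2 * e + f) mod 3 + g) mod 3 = (2 * e + (f + g) mod 3) mod 3"
    "((e + f) mod 3 + g) mod 3 = (e + (f + g) mod 3) mod 3"
    unfolding mod_add_right_eq mod_add_left_eq by (simp_all add: algebra_simps)
  moreover have "(2 * ((2 * e + f) mod 3) + g) mod 3 = (e + (2 * f + g) mod 3) mod 3"
  proof -
    \<comment> \<open>Conjugating twice by odd powers of \<open>a\<close> doubles the exponent of
      \<open>b\<close> twice, and 4 = 1 modulo 3.\<close>
    have "2 * (2 * e + f) + g = 3 * e + (e + (2 * f + g))" by simp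
    then show ?thesis unfolding dbl mod_add_right_eq by (metis mod_mult_self4)
  qed
  ultimately show "x \<otimes>\<^bsub>U n\<^esub> y \<otimes>\<^bsub>U n\<^esub> z = x \<otimes>\<^bsub>U n\<^esub> (y \<otimes>\<^bsub>U n\<^esub> z)"
    unfolding eqs mult_U prod.inject even_mod_double even_add
    by (cases "even j"; cases "even k"; simp only: if_True if_False simp_thms)
next
  fix x assume x: "x \<in> carrier (U n)"
  obtain i e where ie: "x = (i, e)" by fastforce
  \<comment> \<open>For odd \<open>i\<close> the product doubles the exponent of the left factor, so
    choosing \<open>e\<close> again gives 2e + e = 0 modulo 3.\<close>
  define y where "y = ((2 * n - i) mod (2 * n), if even i then (3 - e) mod 3 else e)"
  have "y \<in> carrier (U n)" using x n by (auto simp: y_def ie)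
  moreover have "y \<otimes>\<^bsub>U n\<^esub> x = \<one>\<^bsub>U n\<^esub>"
  proof -
    have "((2 * n - i) mod (2 * n) + i) mod (2 * n) = 0"
      using x unfolding mod_add_left_eq by (simp add: ie)
    moreover have "((3 - e) mod 3 + e) mod 3 = 0"
      using x unfolding mod_add_left_eq by (simp add: ie)
    ultimately show ?thesis by (simp add: y_def ie)
  qed
  ultimately show "\<exists>y\<in>carrier (U n). y \<otimes>\<^bsub>U n\<^esub> x = \<one>\<^bsub>U n\<^esub>" by blast
qed (use n in \<open>auto split: if_splits\<close>)

lemma inv_U_rotation:
  assumes "n \<ge> 1" "i < 2 * n" "even i"
  shows "inv\<^bsub>U n\<^esub> (i, 0) = ((2 * n - i) mod (2 * n), 0)"
proof -
  interpret group "U n" by (rule group_U[OF assms(1)])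
  have "((2 * n - i) mod (2 * n) + i) mod (2 * n) = 0"
    using assms unfolding mod_add_left_eq by simp
  then show ?thesis using assms by (intro inv_equality) auto
qed

lemma subgroup_multiples_U:
  assumes n: "n \<ge> 1" and d: "d dvd n"
  shows "subgroup {(2 * r, 0) | r. r < n \<and> d dvd r} (U n)" (is "subgroup ?H _")
proof -
  interpret group "U n" by (rule group_U[OF n])
  have sub: "?H \<subseteq> carrier (U n)" by auto
  have half: "2 * k mod (2 * n) = 2 * (k mod n)" for k by (rule mult_mod_right[symmetric])
  have mem: "(2 * k mod (2 * n), 0) \<in> ?H" if "d dvd k" for k
    using that n d by (auto simp: half dvd_mod)
  show ?thesis
  proof (rule subgroupI)
    show "?H \<noteq> {}" using mem[of 0] by auto
  next
    fix x assume "x \<in> ?H"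
    then obtain r where r: "x = (2 * r, 0)" "r < n" "d dvd r" by auto
    have "inv\<^bsub>U n\<^esub> x = (2 * (n - r) mod (2 * n), 0)"
      using inv_U_rotation[OF n, of "2 * r"] r by (simp add: diff_mult_distrib2)
    then show "inv\<^bsub>U n\<^esub> x \<in> ?H" using mem[of "n - r"] r d by simp
  next
    fix x y assume "x \<in> ?H" "y \<in> ?H"
    then obtain r s where "x = (2 * r, 0)" "d dvd r" "y = (2 * s, 0)" "d dvd s" by auto
    then show "x \<otimes>\<^bsub>U n\<^esub> y \<in> ?H" using mem[of "r + s"] by simp
  qed (rule sub)
qed

lemma subgroup_multiples_U_A2:
  assumes n: "n \<ge> 1" and d: "d dvd n"
  shows "subgroup {(2 * r, 0) | r. r < n \<and> d dvd r} (U_A2 n)"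
  using group.subgroup_incl[OF group_U[OF n] subgroup_multiples_U[OF n d] subgroup_multiples_U[OF n, of 1]]
  by (fastforce simp: U_A2_def A2_def)

lemma group_U_A2: "n \<ge> 1 \<Longrightarrow> group (U_A2 n)"
  using group.subgroup_imp_group[OF group_U subgroup_multiples_U[of n 1]]
  by (simp add: U_A2_def A2_def)

text \<open>Forward, characters have rational sums over the Boolean algebra. Backward,
  \<open>L\<close> is a union of classes of equal gcd with n, and each class is a Boolean
  combination of subgroups.\<close>

lemma boolean_alg_U_A2_iff:
  assumes n: "n \<ge> 1" and L: "L \<subseteq> {0..<n}"
  shows "{(2 * l, 0) | l. l \<in> L} \<in> boolean_alg (U_A2 n) \<longleftrightarrow>
    (\<forall>z::complex. z ^ n = 1 \<longrightarrow> (\<Sum>l\<in>L. z ^ l) \<in> \<rat>)" (is "?SL \<in> _ \<longleftrightarrow> ?R")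
proof
  interpret A2: group "U_A2 n" by (rule group_U_A2[OF n])
  have carr: "carrier (U_A2 n) = {(2 * r, 0) | r. r < n}" by (simp add: U_A2_def A2_def)
  { assume mem: "?SL \<in> boolean_alg (U_A2 n)"
    show ?R
    proof (intro allI impI)
      fix z :: complex assume z: "z ^ n = 1"
      \<comment> \<open>The character of the cyclic group taking a^(2r) to z^r.\<close>
      define c where "c = (\<lambda>x::nat \<times> nat. z ^ (fst x div 2))"
      have "sum c ?SL \<in> \<rat>"
      proof (rule A2.char_sum_boolean_alg_rational[OF _ mem])
        have "carrier (U_A2 n) = (\<lambda>r. (2 * r, 0)) ` {..<n}" unfolding carr by auto
        then show "finite (carrier (U_A2 n))" by simp
        fix x y assume "x \<in> carrier (U_A2 n)" "y \<in> carrier (U_A2 n)"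
        then obtain r s where xy: "x = (2 * r, 0)" "y = (2 * s, 0)" unfolding carr by auto
        have "(2 * r + 2 * s) mod (2 * n) = 2 * ((r + s) mod n)"
          unfolding distrib_left[symmetric] by (rule mult_mod_right[symmetric])
        then show "c (x \<otimes>\<^bsub>U_A2 n\<^esub> y) = c x * c y"
          by (simp add: U_A2_def xy c_def power_mod_root_of_unity[OF z] power_add)
      qed
      also have "?SL = (\<lambda>l. (2 * l, 0)) ` L" by auto
      also have "sum c \<dots> = (\<Sum>l\<in>L. z ^ l)"
        by (subst sum.reindex) (auto simp: inj_on_def c_def)
      finally show "(\<Sum>l\<in>L. z ^ l) \<in> \<rat>" .
    qed
  next
    assume R: ?R
    define H where "H = (\<lambda>d. {(2 * r, 0::nat) | r. r < n \<and> d dvd r})"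
    \<comment> \<open>Removing the subgroups that belong to proper multiples of \<open>g\<close>
      leaves exactly the elements whose gcd with n is \<open>g\<close>.\<close>
    define K where "K = (\<lambda>g. H g \<inter> (carrier (U_A2 n) - (\<Union>d\<in>{d. d dvd n \<and> g dvd d \<and> d \<noteq> g}. H d)))"
    have H: "H d \<in> boolean_alg (U_A2 n)" if "d dvd n" for d
      unfolding H_def by (intro boolean_alg.subgrp subgroup_multiples_U_A2 n that)
    have fin: "finite {d. d dvd n \<and> P d}" for P
      using n by (intro finite_subset[OF _ finite_divisors_nat[of n]]) auto
    have K: "K g \<in> boolean_alg (U_A2 n)" if "g dvd n" for g
      unfolding K_def using that fin
      by (intro boolean_alg.inter boolean_alg.compl boolean_alg_UN A2.group_axioms H) auto
    have K_eq: "K g = {(2 * r, 0) | r. r < n \<and> gcd r n = g}" if g: "g dvd n" for g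
    proof -
      have gcd_iff: "g dvd r \<and> (\<forall>d. d dvd n \<and> g dvd d \<and> d \<noteq> g \<longrightarrow> \<not> d dvd r) \<longleftrightarrow> gcd r n = g" for r
        using g by (metis dvd_antisym gcd_dvd1 gcd_dvd2 gcd_greatest)
      have form: "\<exists>r. x = (2 * r, 0)" if "x \<in> K g" for x
        using that by (auto simp: K_def H_def)
      have "(2 * r, 0) \<in> K g \<longleftrightarrow>
        r < n \<and> g dvd r \<and> (\<forall>d. d dvd n \<and> g dvd d \<and> d \<noteq> g \<longrightarrow> \<not> d dvd r)" for r
      proof -
        have "(2 * r, 0) \<in> H d \<longleftrightarrow> r < n \<and> d dvd r" for d by (auto simp: H_def)
        moreover have "(2 * r, 0) \<in> carrier (U_A2 n) \<longleftrightarrow> r < n" by (auto simp: carr)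
        ultimately show ?thesis unfolding K_def by blast
      qed
      then have mem: "(2 * r, 0) \<in> K g \<longleftrightarrow> r < n \<and> gcd r n = g" for r
        by (simp only: gcd_iff)
      show ?thesis
      proof (intro Set.set_eqI iffI)
        fix x assume x: "x \<in> K g"
        then obtain r where "x = (2 * r, 0)" using form by blast
        with x mem[of r] show "x \<in> {(2 * r, 0) | r. r < n \<and> gcd r n = g}" by simp
      qed (use mem in auto)
    qed
    have "?SL = (\<Union>l\<in>L. K (gcd l n))"
    proof
      show "?SL \<subseteq> (\<Union>l\<in>L. K (gcd l n))"
      proof
        fix x assume "x \<in> ?SL"
        then obtain l where l: "x = (2 * l, 0)" "l \<in> L" by blast
        moreover have "l < n" using L l by auto
        ultimately have "x \<in> K (gcd l n)" unfolding K_eq[OF gcd_dvd2] by blast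
        then show "x \<in> (\<Union>l\<in>L. K (gcd l n))" using l(2) by blast
      qed
      show "(\<Union>l\<in>L. K (gcd l n)) \<subseteq> ?SL"
      proof
        fix x assume "x \<in> (\<Union>l\<in>L. K (gcd l n))"
        then obtain l r where lr: "l \<in> L" "x = (2 * r, 0)" "r < n" "gcd r n = gcd l n"
          by (auto simp: K_eq)
        have "r \<in> L"
          by (rule rational_char_sums_imp_gcd_closed[OF _ L _ lr(1,3)]) (use n R lr in auto)
        then show "x \<in> ?SL" using lr by blast
      qed
    qed
    also have "\<dots> \<in> boolean_alg (U_A2 n)"
      using L by (intro boolean_alg_UN A2.group_axioms K) (auto intro: finite_subset)
    finally show "?SL \<in> boolean_alg (U_A2 n)" .
  }
qed

subsection \<open>Eigenfunctions of Cayley graphs\<close>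

text \<open>As \<open>S\<close> is closed under inversion, both ways of being adjacent reduce to y =
  s x, and right cancellation makes each neighbour arise from only one s.\<close>

lemma (in group) cayley_adj_mult_vec:
  fixes f :: "'a \<Rightarrow> complex"
  assumes xs: "set xs = carrier G" "distinct xs"
    and S: "S \<subseteq> carrier G" "S = (\<lambda>x. inv x) ` S" and p: "p < length xs"
  shows "(cayley_adj G S xs *\<^sub>v vec (length xs) (\<lambda>q. f (xs ! q))) $ p = (\<Sum>s\<in>S. f (s \<otimes> xs ! p))"
proof -
  define x where "x = xs ! p"
  have x: "x \<in> carrier G" using nth_mem[OF p] xs(1) by (simp add: x_def)
  have fin: "finite (carrier G)" unfolding xs(1)[symmetric] by (rule List.finite_set)
  have adj: "(\<exists>s\<in>S. y = s \<otimes> x \<or> x = s \<otimes> y) \<longleftrightarrow> y \<in> (\<lambda>s. s \<otimes> x) ` S" if y: "y \<in> carrier G" for y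
  proof
    assume "\<exists>s\<in>S. y = s \<otimes> x \<or> x = s \<otimes> y"
    then obtain s where s: "s \<in> S" "y = s \<otimes> x \<or> x = s \<otimes> y" by blast
    have "inv s \<in> S" using s(1) S(2) by blast
    moreover have "y = inv s \<otimes> x" if "x = s \<otimes> y"
      using that y s(1) S(1) by (auto simp: subset_iff m_assoc[symmetric])
    ultimately show "y \<in> (\<lambda>s. s \<otimes> x) ` S" using s by blast
  qed auto
  have inj: "inj_on (\<lambda>s. s \<otimes> x) S" using x S(1) by (auto simp: inj_on_def subset_iff)
  have "(cayley_adj G S xs *\<^sub>v vec (length xs) (\<lambda>q. f (xs ! q))) $ p =
      (\<Sum>q<length xs. if \<exists>s\<in>S. xs ! q = s \<otimes> x \<or> x = s \<otimes> xs ! q then f (xs ! q) else 0)"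
    using p unfolding cayley_adj_def x_def
    by (auto simp: scalar_prod_def lessThan_atLeast0 intro!: sum.cong)
  also have "\<dots> = (\<Sum>y\<in>carrier G. if \<exists>s\<in>S. y = s \<otimes> x \<or> x = s \<otimes> y then f y else 0)"
    by (rule sum.reindex_bij_betw[OF bij_betw_nth]) (use xs in auto)
  also have "\<dots> = (\<Sum>y\<in>carrier G. if y \<in> (\<lambda>s. s \<otimes> x) ` S then f y else 0)"
    by (intro sum.cong refl if_cong adj)
  also have "\<dots> = (\<Sum>y\<in>(\<lambda>s. s \<otimes> x) ` S. f y)"
    using fin x S(1) by (intro sum.mono_neutral_cong_right) auto
  also have "\<dots> = (\<Sum>s\<in>S. f (s \<otimes> x))"
    using inj by (simp add: sum.reindex)
  finally show ?thesis by (simp add: x_def)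
qed

text \<open>Since the list enumerates the group without repetition, vectors and functions on the
  group correspond, and matrices can be left behind.\<close>

lemma (in group) eigenvalue_cayley_adj_iff:
  assumes xs: "set xs = carrier G" "distinct xs"
    and S: "S \<subseteq> carrier G" "S = (\<lambda>x. inv x) ` S"
  shows "eigenvalue (cayley_adj G S xs) ev \<longleftrightarrow>
    (\<exists>f::'a \<Rightarrow> complex. (\<exists>x\<in>carrier G. f x \<noteq> 0) \<and> (\<forall>x\<in>carrier G. (\<Sum>s\<in>S. f (s \<otimes> x)) = ev * f x))"
proof -
  let ?M = "cayley_adj G S xs" and ?m = "length xs"
  have dim: "dim_row ?M = ?m" by (simp add: cayley_adj_def)
  have eigvec: "eigenvector ?M (vec ?m (\<lambda>q. f (xs ! q))) ev \<longleftrightarrow>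
     (\<exists>x\<in>carrier G. f x \<noteq> 0) \<and> (\<forall>x\<in>carrier G. (\<Sum>s\<in>S. f (s \<otimes> x)) = ev * f x)" for f
  proof -
    have "vec ?m (\<lambda>q. f (xs ! q)) \<noteq> 0\<^sub>v ?m \<longleftrightarrow> (\<exists>x\<in>carrier G. f x \<noteq> 0)"
    proof -
      have "(\<exists>x\<in>set xs. f x \<noteq> 0) \<longleftrightarrow> (\<exists>q<?m. f (xs ! q) \<noteq> 0)"
        by (metis in_set_conv_nth)
      then show ?thesis unfolding xs(1)[symmetric] by (auto simp: vec_eq_iff)
    qed
    moreover have "?M *\<^sub>v vec ?m (\<lambda>q. f (xs ! q)) = ev \<cdot>\<^sub>v vec ?m (\<lambda>q. f (xs ! q)) \<longleftrightarrow>
      (\<forall>p<?m. (?M *\<^sub>v vec ?m (\<lambda>q. f (xs ! q))) $ p = ev * f (xs ! p))"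
      using dim by (auto simp: vec_eq_iff)
    moreover have "\<dots> \<longleftrightarrow> (\<forall>x\<in>carrier G. (\<Sum>s\<in>S. f (s \<otimes> x)) = ev * f x)"
      unfolding xs(1)[symmetric] using cayley_adj_mult_vec[OF xs S]
      by (auto simp: all_set_conv_all_nth)
    ultimately show ?thesis by (simp add: eigenvector_def dim)
  qed
  have "\<exists>f. v = vec ?m (\<lambda>q. f (xs ! q))" if "v \<in> carrier_vec ?m" for v :: "complex vec"
  proof (intro exI eq_vecI)
    let ?f = "\<lambda>x. v $ inv_into {..<?m} ((!) xs) x"
    have inj: "inj_on ((!) xs) {..<?m}" using xs(2) by (simp add: inj_on_nth)
    fix q assume "q < dim_vec (vec ?m (\<lambda>q. ?f (xs ! q)))"
    then show "v $ q = vec ?m (\<lambda>q. ?f (xs ! q)) $ q"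
      using inv_into_f_f[OF inj, of q] by simp
  qed (use that in auto)
  then have "eigenvalue ?M ev \<longleftrightarrow> (\<exists>f. eigenvector ?M (vec ?m (\<lambda>q. f (xs ! q))) ev)"
    unfolding eigenvalue_def by (metis dim eigenvector_def)
  then show ?thesis by (simp add: eigvec)
qed

lemma rational_eigenvalue_cayley_adj:
  "eigenvalue (cayley_adj G S xs) ev \<Longrightarrow> ev \<in> \<rat> \<Longrightarrow> ev \<in> \<int>"
  by (rule rational_eigenvalue_int_matrix[of _ "length xs"]) (auto simp: cayley_adj_def)

text \<open>The adjacency operator is symmetric for the bilinear pairing of functions, so an eigenvalue
  can be read off from the pairing of its eigenfunction with explicit test functions.\<close>

lemma (in group) eigenfunction_pairing:
  fixes f h :: "'a \<Rightarrow> complex"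
  assumes S: "S \<subseteq> carrier G" "S = (\<lambda>x. inv x) ` S"
    and f: "\<And>x. x \<in> carrier G \<Longrightarrow> (\<Sum>s\<in>S. f (s \<otimes> x)) = ev * f x"
  shows "ev * (\<Sum>x\<in>carrier G. f x * h x) = (\<Sum>x\<in>carrier G. f x * (\<Sum>s\<in>S. h (s \<otimes> x)))"
proof -
  have "ev * (\<Sum>x\<in>carrier G. f x * h x) = (\<Sum>x\<in>carrier G. (\<Sum>s\<in>S. f (s \<otimes> x)) * h x)"
    by (simp add: sum_distrib_left f mult.assoc)
  also have "\<dots> = (\<Sum>s\<in>S. \<Sum>x\<in>carrier G. f (s \<otimes> x) * h x)"
    unfolding sum_distrib_right by (rule sum.swap)
  also have "\<dots> = (\<Sum>s\<in>S. \<Sum>x\<in>carrier G. f x * h (inv s \<otimes> x))"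
  proof (rule sum.cong[OF refl])
    fix s assume "s \<in> S"
    then have s: "s \<in> carrier G" using S by blast
    \<comment> \<open>Writing x as s^(-1)(s x) makes the summand a function of s x alone, ready for
      translation.\<close>
    have "(\<Sum>x\<in>carrier G. f (s \<otimes> x) * h x) = (\<Sum>x\<in>carrier G. f (s \<otimes> x) * h (inv s \<otimes> (s \<otimes> x)))"
      using s by (intro sum.cong) (auto simp: m_assoc[symmetric])
    also have "\<dots> = (\<Sum>x\<in>carrier G. f x * h (inv s \<otimes> x))"
      by (rule sum_translate[OF subgroup_self s])
    finally show "(\<Sum>x\<in>carrier G. f (s \<otimes> x) * h x) = (\<Sum>x\<in>carrier G. f x * h (inv s \<otimes> x))" .
  qed
  also have "\<dots> = (\<Sum>x\<in>carrier G. f x * (\<Sum>s\<in>S. h (inv s \<otimes> x)))"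
    unfolding sum_distrib_left by (rule sum.swap)
  also have "\<dots> = (\<Sum>x\<in>carrier G. f x * (\<Sum>s\<in>S. h (s \<otimes> x)))"
  proof -
    have "(\<Sum>s\<in>(\<lambda>x. inv x) ` S. h (s \<otimes> x)) = (\<Sum>s\<in>S. h (inv s \<otimes> x))" for x
      using inj_on_subset[OF inv_inj S(1)] by (simp add: sum.reindex)
    then show ?thesis using S(2) by simp
  qed
  finally show ?thesis .
qed

subsection \<open>Waves on \<open>U n\<close>\<close>

text \<open>For \<open>z \<noteq> 1\<close> the two waves with \<open>p = True\<close> and \<open>p = False\<close> span a copy of the degree-two
  representation with \<open>a\<^sup>2 \<mapsto> w\<^sup>2\<close>; for \<open>z = 1\<close> their sum is a linear character.\<close>

definition wave :: "complex \<Rightarrow> complex \<Rightarrow> bool \<Rightarrow> nat \<times> nat \<Rightarrow> complex" where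
  "wave w z p x = (if even (fst x) = p then w ^ fst x * z ^ snd x else 0)"

text \<open>The factor a wave acquires when \<open>x\<close> multiplies from the left an element
  whose a-exponent is even (\<open>p = True\<close>) or odd (\<open>p = False\<close>); passing an
  odd power of \<open>a\<close> doubles the exponent of \<open>b\<close>.\<close>

definition weight :: "complex \<Rightarrow> complex \<Rightarrow> bool \<Rightarrow> nat \<times> nat \<Rightarrow> complex" where
  "weight w z p x = w ^ fst x * z ^ (if p then snd x else 2 * snd x)"

lemma wave_mult:
  assumes w: "w ^ (2 * n) = 1" and z: "z ^ 3 = 1"
  shows "wave w z p (x \<otimes>\<^bsub>U n\<^esub> y) =
    (if even (fst x) then weight w z p x * wave w z p y else weight w z (\<not> p) x * wave w z (\<not> p) y)"
proof -
  obtain s t where x: "x = (s, t)" by fastforce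
  obtain i e where y: "y = (i, e)" by fastforce
  have "wave w z p (x \<otimes>\<^bsub>U n\<^esub> y) =
    (if even (s + i) = p then w ^ (s + i) * z ^ (if even i then t + e else 2 * t + e) else 0)"
    unfolding wave_def x y mult_U fst_conv snd_conv even_mod_double
      power_mod_root_of_unity[OF w] power_mod_root_of_unity[OF z] ..
  then show ?thesis by (cases p) (auto simp: wave_def weight_def x y power_add)
qed

text \<open>Even elements preserve the parity class and odd ones exchange the two, so
  \<open>A\<close> gives the diagonal and \<open>B\<close> the off-diagonal entries of a 2 x 2
  block.\<close>

lemma sum_wave_mult:
  assumes w: "w ^ (2 * n) = 1" and z: "z ^ 3 = 1"
    and fin: "finite A" "finite B" and A: "\<And>x. x \<in> A \<Longrightarrow> even (fst x)" and B: "\<And>x. x \<in> B \<Longrightarrow> odd (fst x)"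
  shows "(\<Sum>x\<in>A \<union> B. wave w z p (x \<otimes>\<^bsub>U n\<^esub> y)) =
    sum (weight w z p) A * wave w z p y + sum (weight w z (\<not> p)) B * wave w z (\<not> p) y"
proof -
  have "(\<Sum>x\<in>A \<union> B. wave w z p (x \<otimes>\<^bsub>U n\<^esub> y)) =
    (\<Sum>x\<in>A. wave w z p (x \<otimes>\<^bsub>U n\<^esub> y)) + (\<Sum>x\<in>B. wave w z p (x \<otimes>\<^bsub>U n\<^esub> y))"
    using A B by (intro sum.union_disjoint fin) auto
  also have "(\<Sum>x\<in>A. wave w z p (x \<otimes>\<^bsub>U n\<^esub> y)) = sum (weight w z p) A * wave w z p y"
    unfolding sum_distrib_right by (intro sum.cong refl) (simp add: wave_mult[OF w z] A)
  also have "(\<Sum>x\<in>B. wave w z p (x \<otimes>\<^bsub>U n\<^esub> y)) = sum (weight w z (\<not> p)) B * wave w z (\<not> p) y"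
    unfolding sum_distrib_right by (intro sum.cong refl) (simp add: wave_mult[OF w z] B)
  finally show ?thesis .
qed

text \<open>The sum of the two waves is w^i z^e. If all pairings vanished, inverting the Fourier
  transform first in i and then in e would give f = 0.\<close>

lemma exists_wave_pairing_nonzero:
  fixes f :: "nat \<times> nat \<Rightarrow> complex"
  assumes x: "x \<in> carrier (U n)" and f: "f x \<noteq> 0"
  shows "\<exists>w z. w ^ (2 * n) = 1 \<and> z ^ 3 = 1 \<and>
    (\<Sum>y\<in>carrier (U n). f y * (wave w z True y + wave w z False y)) \<noteq> 0"
proof (rule ccontr)
  assume "\<not> ?thesis"
  moreover have "wave w z True y + wave w z False y = w ^ fst y * z ^ snd y" for w z y
    by (auto simp: wave_def)
  ultimately have zero: "(\<Sum>y\<in>carrier (U n). f y * (w ^ fst y * z ^ snd y)) = 0"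
    if "w ^ (2 * n) = 1" "z ^ 3 = 1" for w z
    using that by auto
  obtain i e where ie: "x = (i, e)" "i < 2 * n" "e < 3" using x by auto
  have row: "(\<Sum>e<3. f (i, e) * z ^ e) = 0" if z: "z ^ 3 = 1" for z
  proof (rule dft_injective[where g = "\<lambda>_. 0", OF _ ie(2)])
    fix w :: complex assume w: "w ^ (2 * n) = 1"
    have "(\<Sum>i<2 * n. (\<Sum>e<3. f (i, e) * z ^ e) * w ^ i) =
      (\<Sum>i<2 * n. \<Sum>e<3. f (i, e) * (w ^ i * z ^ e))"
      unfolding sum_distrib_right by (intro sum.cong refl) (simp only: mult_ac)
    also have "\<dots> = (\<Sum>y\<in>carrier (U n). f y * (w ^ fst y * z ^ snd y))"
      by (simp add: sum.cartesian_product lessThan_atLeast0 case_prod_unfold)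
    also have "\<dots> = 0" by (rule zero[OF w z])
    finally show "(\<Sum>i<2 * n. (\<Sum>e<3. f (i, e) * z ^ e) * w ^ i) = (\<Sum>i<2 * n. 0 * w ^ i)"
      by simp
  qed
  have "f (i, e) = 0"
    by (rule dft_injective[where g = "\<lambda>_. 0" and f = "\<lambda>e. f (i, e)", OF _ ie(3)]) (simp add: row)
  with f ie show False by simp
qed

section \<open>Cube roots of unity and the characters expressed by weights\<close>

lemma cube_root_sum:
  fixes z :: "'a::idom"
  assumes "z ^ 3 = 1" "z \<noteq> 1"
  shows "z + z ^ 2 = -1"
proof -
  have "(z - 1) * (z + z ^ 2 + 1) = z ^ 3 - 1" by (simp add: algebra_simps power2_eq_square power3_eq_cube)
  then have "z + z ^ 2 + 1 = 0" using assms by simp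
  then show ?thesis by (simp add: eq_neg_iff_add_eq_0)
qed

lemma exists_primitive_cube_root: "\<exists>z::complex. z ^ 3 = 1 \<and> z \<noteq> 1"
proof (rule ccontr)
  assume "\<not> ?thesis"
  then have "{z::complex. z ^ 3 = 1} \<subseteq> {1}" by auto
  then have "card {z::complex. z ^ 3 = 1} \<le> card {1::complex}" by (intro card_mono) auto
  then show False by (simp add: card_roots_unity_eq)
qed

lemma omega_eq_cis: "omega n = cis (pi / n)"
  by (simp add: omega_def cis_conv_exp mult.commute)

lemma omega_power:
  assumes n: "n \<ge> 1"
  shows "omega n ^ (2 * n) = 1"
  using n by (simp add: omega_eq_cis Complex.DeMoivre)

lemma root_of_unity_omega:
  assumes n: "n \<ge> 1" and w: "w ^ (2 * n) = 1"
  shows "\<exists>j<2 * n. w = omega n ^ j"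
proof -
  have "bij_betw (\<lambda>k. cis (2 * pi * real k / real (2 * n))) {..<2 * n} {z. z ^ (2 * n) = 1}"
    using n by (intro Complex.bij_betw_roots_unity) auto
  then have "w \<in> (\<lambda>k. cis (2 * pi * real k / real (2 * n))) ` {..<2 * n}"
    using w by (auto simp: bij_betw_def)
  then show ?thesis
    by (auto simp: omega_eq_cis Complex.DeMoivre mult.commute)
qed

lemma chi_eq: "chi n j x = (omega n ^ j) ^ fst x"
  by (auto simp: chi_def Let_def power_mult[symmetric] mult_ac elim!: evenE oddE)

text \<open>Only even powers of \<open>w\<close> enter, so either square root of \<omega>^(2k) may
  serve as \<open>w\<close>.\<close>

lemma psi_eq:
  assumes "even (fst x)" "w ^ 2 = omega n ^ (2 * k)"
  shows "psi n k x = w ^ fst x * (if snd x = 0 then 2 else -1)"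
proof -
  have "omega n ^ (2 * k * (fst x div 2)) = (w ^ 2) ^ (fst x div 2)"
    by (simp only: power_mult assms(2))
  also have "\<dots> = w ^ fst x" using assms(1) by (simp flip: power_mult)
  finally show ?thesis using assms(1) by (simp add: psi_def Let_def)
qed

lemma char_set_chi: "char_set (chi n j) A = sum (weight (omega n ^ j) 1 p) A"
  by (simp add: char_set_def chi_eq weight_def)

text \<open>Odd elements act by antidiagonal blocks, and the trace of a product of two such blocks
  is a sum of two products of weights; after summation over all ordered pairs both contribute
  equally.\<close>

lemma char_set_sq_psi:
  assumes w: "w ^ (2 * n) = 1" "w ^ 2 = omega n ^ (2 * k)" and z: "z ^ 3 = 1" "z \<noteq> 1"
    and A: "\<And>x. x \<in> A \<Longrightarrow> odd (fst x)"
  shows "char_set_sq (U n) (psi n k) A = 2 * (sum (weight w z True) A * sum (weight w z False) A)"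
proof -
  have psi: "psi n k (x \<otimes>\<^bsub>U n\<^esub> y) =
      weight w z False x * weight w z True y + weight w z True x * weight w z False y"
    if xy: "x \<in> A" "y \<in> A" for x y
  proof -
    obtain s t where x: "x = (s, t)" by fastforce
    obtain i e where y: "y = (i, e)" by fastforce
    have odd: "odd s" "odd i" using A xy by (auto simp: x y)
    \<comment> \<open>The exponent of \<open>b\<close> in the product, before reduction modulo
      3.\<close>
    define m where "m = 2 * t + e"
    have "psi n k (x \<otimes>\<^bsub>U n\<^esub> y) = w ^ (s + i) * (if m mod 3 = 0 then 2 else -1)"
      using odd by (subst psi_eq[OF _ w(2)]) (simp_all add: x y m_def power_mod_root_of_unity[OF w(1)])
    also have "(if m mod 3 = 0 then 2 else -1) = z ^ m + z ^ (2 * m)"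
    proof -
      have "z ^ m + z ^ (2 * m) = z ^ (m mod 3) + (z ^ (m mod 3)) ^ 2"
        by (simp add: power_mod_root_of_unity[OF z(1)] flip: power_mult add: mult.commute)
      moreover have "m mod 3 = 0 \<or> m mod 3 = 1 \<or> m mod 3 = 2" by presburger
      moreover have "z ^ 4 = z" using z(1) by (simp add: eval_nat_numeral)
      ultimately show ?thesis using cube_root_sum[OF z] by (auto simp: add.commute power2_eq_square[symmetric] simp flip: power_mult)
    qed
    also have "z ^ (2 * m) = z ^ (t + 2 * e)"
    proof -
      have "2 * m = 3 * t + (t + 2 * e)" by (simp add: m_def)
      then show ?thesis by (simp only: power_add power_mult z(1) power_one mult_1_left)
    qed
    finally show ?thesis
      by (simp add: weight_def x y m_def power_add algebra_simps)
  qed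
  have "char_set_sq (U n) (psi n k) A =
    (\<Sum>x\<in>A. \<Sum>y\<in>A. weight w z False x * weight w z True y + weight w z True x * weight w z False y)"
    unfolding char_set_sq_def by (intro sum.cong refl psi)
  also have "\<dots> = 2 * (sum (weight w z True) A * sum (weight w z False) A)"
    unfolding sum.distrib sum_product[symmetric] by (simp add: mult.commute)
  finally show ?thesis .
qed

lemma U_list_carrier: "set (U_list n) = carrier (U n)" "distinct (U_list n)"
proof -
  show "set (U_list n) = carrier (U n)" by (auto simp: U_list_def)
  have "U_list n = List.product [0..<2*n] [0..<3]" by (simp add: U_list_def product_concat_map)
  then show "distinct (U_list n)" by (simp add: distinct_product)
qed

subsection \<open>The spectrum of \<open>Cay(U n, S)\<close>\<close>

text \<open>Each pair (w, z) gives a block with scalar diagonal and the weights of \<open>B\<close>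
  off the diagonal. Pairing an eigenfunction with waves yields an eigenvector of some block;
  conversely, block eigenvectors give eigenfunctions.\<close>

lemma eigenvalue_cayley_U_iff:
  fixes \<sigma> :: "complex \<Rightarrow> complex"
  assumes n: "n \<ge> 1"
    and A: "A \<subseteq> carrier (U n)" "\<And>x. x \<in> A \<Longrightarrow> even (fst x)"
    and B: "B \<subseteq> carrier (U n)" "\<And>x. x \<in> B \<Longrightarrow> odd (fst x)"
    and inv: "A \<union> B = (\<lambda>x. inv\<^bsub>U n\<^esub> x) ` (A \<union> B)"
    and \<sigma>: "\<And>w z p. w ^ (2 * n) = 1 \<Longrightarrow> z ^ 3 = 1 \<Longrightarrow>
      sum (weight w z p) A = (if z = 1 then 2 * \<sigma> w else - \<sigma> w)"
  shows "eigenvalue (cayley_adj (U n) (A \<union> B) (U_list n)) ev \<longleftrightarrow>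
    (\<exists>w. w ^ (2 * n) = 1 \<and> (ev = 2 * \<sigma> w + sum (weight w 1 True) B \<or>
      (\<exists>z. z ^ 3 = 1 \<and> z \<noteq> 1 \<and>
        (ev + \<sigma> w)\<^sup>2 = sum (weight w z True) B * sum (weight w z False) B)))"
    (is "?E \<longleftrightarrow> ?R")
proof -
  interpret group "U n" by (rule group_U[OF n])
  have fin: "finite A" "finite B" using finite_subset[OF A(1)] finite_subset[OF B(1)] by auto
  have AB: "A \<union> B \<subseteq> carrier (U n)" using A(1) B(1) by blast
  have op: "(\<Sum>s\<in>A \<union> B. wave w z p (s \<otimes>\<^bsub>U n\<^esub> y)) = (if z = 1 then 2 * \<sigma> w else - \<sigma> w) * wave w z p y
      + sum (weight w z (\<not> p)) B * wave w z (\<not> p) y"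
    if "w ^ (2 * n) = 1" "z ^ 3 = 1" for w z p y
    unfolding \<sigma>[OF that, of p, symmetric]
    by (rule sum_wave_mult[OF that fin]) (use A(2) B(2) in auto)
  have weight1: "weight w 1 False = weight w 1 True" for w
  proof (rule ext)
    fix x show "weight w 1 False x = weight w 1 True x" unfolding weight_def by simp
  qed
  have E_iff: "?E \<longleftrightarrow> (\<exists>f. (\<exists>x\<in>carrier (U n). f x \<noteq> 0) \<and>
      (\<forall>x\<in>carrier (U n). (\<Sum>s\<in>A \<union> B. f (s \<otimes>\<^bsub>U n\<^esub> x)) = ev * f x))"
    by (rule eigenvalue_cayley_adj_iff[OF U_list_carrier AB inv])
  have origin: "(0, 0) \<in> carrier (U n)" "(1, 0) \<in> carrier (U n)" using n by auto
  show ?thesis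
  proof
    assume ?E
    then obtain f x where x: "x \<in> carrier (U n)" "f x \<noteq> 0"
      and f: "\<And>x. x \<in> carrier (U n) \<Longrightarrow> (\<Sum>s\<in>A \<union> B. f (s \<otimes>\<^bsub>U n\<^esub> x)) = ev * f x"
      unfolding E_iff by blast
    obtain w z where wz: "w ^ (2 * n) = 1" "z ^ 3 = 1"
      and nz: "(\<Sum>y\<in>carrier (U n). f y * (wave w z True y + wave w z False y)) \<noteq> 0"
      using exists_wave_pairing_nonzero[of x n f] x by blast
    define P where "P = (\<lambda>p. \<Sum>y\<in>carrier (U n). f y * wave w z p y)"
    define \<beta> where "\<beta> = (\<lambda>p. sum (weight w z p) B)"
    have P_nz: "P True + P False \<noteq> 0"
      using nz by (simp only: P_def distrib_left sum.distrib not_False_eq_True)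
    have ev_P: "ev * P p = (if z = 1 then 2 * \<sigma> w else - \<sigma> w) * P p + \<beta> (\<not> p) * P (\<not> p)" for p
    proof -
      have "ev * P p = (\<Sum>y\<in>carrier (U n). f y * (\<Sum>s\<in>A \<union> B. wave w z p (s \<otimes>\<^bsub>U n\<^esub> y)))"
        unfolding P_def by (rule eigenfunction_pairing[OF AB inv f])
      also have "\<dots> = (if z = 1 then 2 * \<sigma> w else - \<sigma> w) * P p + \<beta> (\<not> p) * P (\<not> p)"
        unfolding op[OF wz] P_def \<beta>_def distrib_left sum.distrib sum_distrib_left
        by (simp only: mult.left_commute)
      finally show ?thesis .
    qed
    show ?R
    proof (cases "z = 1")
      \<comment> \<open>The off-diagonal entries agree here, so adding the two equations isolates
        the nonzero quantity \<open>P True + P False\<close>.\<close>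
      case True
      have "\<beta> False = \<beta> True" by (simp add: \<beta>_def True weight1)
      then have "ev * (P True + P False) = (2 * \<sigma> w + \<beta> True) * (P True + P False)"
        using ev_P[of True] ev_P[of False] True by (simp add: algebra_simps)
      then have "ev = 2 * \<sigma> w + \<beta> True" using P_nz by simp
      then show ?thesis using wz True by (auto simp: \<beta>_def)
    next
      case False
      have step: "(ev + \<sigma> w) * P p = \<beta> (\<not> p) * P (\<not> p)" for p
        using ev_P[of p] False by (simp add: algebra_simps)
      \<comment> \<open>Applying the antidiagonal part twice returns to the same component.\<close>
      have sq: "(ev + \<sigma> w)\<^sup>2 * P p = \<beta> (\<not> p) * \<beta> p * P p" for p
      proof -
        have "(ev + \<sigma> w)\<^sup>2 * P p = \<beta> (\<not> p) * ((ev + \<sigma> w) * P (\<not> p))"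
          using step[of p] by (simp add: power2_eq_square mult.left_commute mult.assoc)
        then show ?thesis using step[of "\<not> p"] by simp
      qed
      have "P True \<noteq> 0 \<or> P False \<noteq> 0" using P_nz by auto
      then have "(ev + \<sigma> w)\<^sup>2 = \<beta> True * \<beta> False"
        using sq[of True] sq[of False] by (auto simp: mult.commute)
      then show ?thesis using wz False by (auto simp: \<beta>_def)
    qed
  next
    assume ?R
    then obtain w where w: "w ^ (2 * n) = 1" and
      cases: "ev = 2 * \<sigma> w + sum (weight w 1 True) B \<or> (\<exists>z. z ^ 3 = 1 \<and> z \<noteq> 1 \<and>
        (ev + \<sigma> w)\<^sup>2 = sum (weight w z True) B * sum (weight w z False) B)" by blast
    have w0: "w \<noteq> 0" using w n by (auto simp: power_0_left)
    from cases show ?E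
    proof
      assume ev: "ev = 2 * \<sigma> w + sum (weight w 1 True) B"
      let ?f = "\<lambda>x. wave w 1 True x + wave w 1 False x"
      have nz: "\<exists>x\<in>carrier (U n). ?f x \<noteq> 0"
        using origin(1) by (intro bexI[of _ "(0, 0)"]) (simp_all add: wave_def)
      have "(\<Sum>s\<in>A \<union> B. ?f (s \<otimes>\<^bsub>U n\<^esub> x)) = ev * ?f x" for x
        using op[OF w, of 1] unfolding sum.distrib by (simp add: weight1 ev algebra_simps)
      then show ?E unfolding E_iff
        by (intro exI[of _ ?f] conjI ballI nz)
    next
      assume "\<exists>z. z ^ 3 = 1 \<and> z \<noteq> 1 \<and>
        (ev + \<sigma> w)\<^sup>2 = sum (weight w z True) B * sum (weight w z False) B"
      then obtain z where z: "z ^ 3 = 1" "z \<noteq> 1"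
        and sq: "(ev + \<sigma> w)\<^sup>2 = sum (weight w z True) B * sum (weight w z False) B" by blast
      define \<beta> where "\<beta> = (\<lambda>p. sum (weight w z p) B)"
      define \<mu> where "\<mu> = ev + \<sigma> w"
      \<comment> \<open>An eigenvector of the antidiagonal block for the eigenvalue \<mu>. If
        \<open>\<beta> False\<close> vanishes, so does \<mu>, and (1, 0) works; otherwise (\<mu>,
        \<open>\<beta> False\<close>) does.\<close>
      have "\<exists>c d. (c \<noteq> 0 \<or> d \<noteq> 0) \<and> c * \<beta> False = \<mu> * d \<and> d * \<beta> True = \<mu> * c"
      proof (cases "\<beta> False = 0")
        case True
        then have "\<mu> = 0" using sq by (simp add: \<mu>_def \<beta>_def)
        then show ?thesis using True by (intro exI[of _ 1] exI[of _ 0]) simp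
      next
        case False
        then show ?thesis using sq
          by (intro exI[of _ \<mu>] exI[of _ "\<beta> False"]) (simp add: \<mu>_def \<beta>_def power2_eq_square mult.commute)
      qed
      then obtain c d where cd: "c \<noteq> 0 \<or> d \<noteq> 0" "c * \<beta> False = \<mu> * d" "d * \<beta> True = \<mu> * c"
        by blast
      let ?f = "\<lambda>x. c * wave w z True x + d * wave w z False x"
      have "?f (0, 0) = c" "?f (1, 0) = d * w" by (simp_all add: wave_def)
      then have nz: "\<exists>x\<in>carrier (U n). ?f x \<noteq> 0"
        using cd(1) w0 origin by (metis mult_eq_0_iff)
      have "(\<Sum>s\<in>A \<union> B. ?f (s \<otimes>\<^bsub>U n\<^esub> x)) = ev * ?f x" for x
      proof -
        have "(\<Sum>s\<in>A \<union> B. ?f (s \<otimes>\<^bsub>U n\<^esub> x)) =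
          - \<sigma> w * ?f x + (c * \<beta> False) * wave w z False x + (d * \<beta> True) * wave w z True x"
          unfolding sum.distrib sum_distrib_left[symmetric] op[OF w z(1)] \<beta>_def
          using z(2) by (simp add: algebra_simps)
        also have "\<dots> = ev * ?f x"
          unfolding cd(2,3) by (simp add: \<mu>_def algebra_simps)
        finally show ?thesis .
      qed
      then show ?E unfolding E_iff by (intro exI[of _ ?f] conjI ballI nz)
    qed
  qed
qed

text \<open>Closure of S_L under inversion equates the sums over l and -l, so both halves of S_1
  carry the same sum, with total factor z + z^2. This is 2 for z = 1 and -1 otherwise; changing
  \<open>p\<close> only swaps z and z^2.\<close>

lemma sum_weight_S1:
  fixes w z :: complex
  assumes n: "n \<ge> 1" and L: "L \<subseteq> {0..<n}"
    and SL_inv: "{(2 * l, 0) | l. l \<in> L} = (\<lambda>x. inv\<^bsub>U n\<^esub> x) ` {(2 * l, 0) | l. l \<in> L}"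
    and w: "w ^ (2 * n) = 1" and z: "z ^ 3 = 1"
  shows "sum (weight w z p) ({(2 * l mod (2 * n), 1) | l. l \<in> L}
      \<union> {((2 * n - 2 * l) mod (2 * n), 2) | l. l \<in> L}) =
    (if z = 1 then 2 * (\<Sum>l\<in>L. (w\<^sup>2) ^ l) else - (\<Sum>l\<in>L. (w\<^sup>2) ^ l))"
proof -
  interpret group "U n" by (rule group_U[OF n])
  let ?SL = "(\<lambda>l. (2 * l, 0::nat)) ` L"
  let ?neg = "\<lambda>l. (2 * n - 2 * l) mod (2 * n)"
  have fin: "finite L" using L finite_subset by blast
  have neg_inj: "inj_on ?neg L"
  proof (rule inj_onI)
    fix l m assume "l \<in> L" "m \<in> L" and eq: "?neg l = ?neg m"
    then have lm: "l < n" "m < n" using L by auto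
    then have "inv\<^bsub>U n\<^esub> (2 * l, 0) = (?neg l, 0)" "inv\<^bsub>U n\<^esub> (2 * m, 0) = (?neg m, 0)"
      by (auto intro!: inv_U_rotation[OF n])
    then have "inv\<^bsub>U n\<^esub> (2 * l, 0) = inv\<^bsub>U n\<^esub> (2 * m, 0)"
      unfolding eq by (rule trans[OF _ sym])
    then have "(2 * l, 0::nat) = (2 * m, 0)"
      by (rule inj_onD[OF inv_inj]) (use lm in auto)
    then show "l = m" by simp
  qed
  have "?SL = (\<lambda>x. inv\<^bsub>U n\<^esub> x) ` ?SL"
    using SL_inv unfolding Setcompr_eq_image by simp
  also have "\<dots> = (\<lambda>l. inv\<^bsub>U n\<^esub> (2 * l, 0)) ` L" by (simp add: image_image)
  also have "\<dots> = (\<lambda>l. (?neg l, 0)) ` L"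
  proof (rule image_cong[OF refl])
    fix l assume "l \<in> L"
    then have "l < n" using L by auto
    then show "inv\<^bsub>U n\<^esub> (2 * l, 0) = (?neg l, 0)" by (intro inv_U_rotation[OF n]) auto
  qed
  finally have SL_eq: "?SL = (\<lambda>l. (?neg l, 0)) ` L" .
  have "(\<Sum>l\<in>L. w ^ ?neg l) = (\<Sum>x\<in>(\<lambda>l. (?neg l, 0::nat)) ` L. w ^ fst x)"
  proof (rule sum.reindex_cong[symmetric])
    show "inj_on (\<lambda>l. (?neg l, 0::nat)) L" using neg_inj by (simp add: inj_on_def)
  qed auto
  also have "\<dots> = (\<Sum>x\<in>?SL. w ^ fst x)" by (simp only: SL_eq)
  also have "\<dots> = (\<Sum>l\<in>L. (w\<^sup>2) ^ l)"
    by (subst sum.reindex) (auto simp: inj_on_def power_mult)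
  finally have neg: "(\<Sum>l\<in>L. w ^ ?neg l) = (\<Sum>l\<in>L. (w\<^sup>2) ^ l)" .
  have "{(2 * l mod (2 * n), 1::nat) | l. l \<in> L} = (\<lambda>l. (2 * l, 1)) ` L"
    using L by (force simp: image_iff)
  moreover have "{(?neg l, 2::nat) | l. l \<in> L} = (\<lambda>l. (?neg l, 2)) ` L" by auto
  ultimately have "sum (weight w z p) ({(2 * l mod (2 * n), 1) | l. l \<in> L} \<union> {(?neg l, 2) | l. l \<in> L})
    = sum (weight w z p) ((\<lambda>l. (2 * l, 1)) ` L) + sum (weight w z p) ((\<lambda>l. (?neg l, 2)) ` L)"
    using fin by (simp only:) (rule sum.union_disjoint; auto)
  also have "sum (weight w z p) ((\<lambda>l. (2 * l, 1)) ` L) =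
      (\<Sum>l\<in>L. (w\<^sup>2) ^ l) * z ^ (if p then 1 else 2)"
    by (subst sum.reindex) (auto simp: inj_on_def weight_def power_mult sum_distrib_right)
  also have "sum (weight w z p) ((\<lambda>l. (?neg l, 2)) ` L) =
      (\<Sum>l\<in>L. w ^ ?neg l) * z ^ (if p then 2 else 4)"
    using neg_inj by (subst sum.reindex) (auto simp: inj_on_def weight_def sum_distrib_right)
  also have "(\<Sum>l\<in>L. (w\<^sup>2) ^ l) * z ^ (if p then 1 else 2) + (\<Sum>l\<in>L. w ^ ?neg l) * z ^ (if p then 2 else 4)
    = (z + z\<^sup>2) * (\<Sum>l\<in>L. (w\<^sup>2) ^ l)"
  proof -
    have "z ^ 4 = z" using z by (simp add: eval_nat_numeral)
    then show ?thesis unfolding neg by (auto simp: algebra_simps)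
  qed
  also have "\<dots> = (if z = 1 then 2 * (\<Sum>l\<in>L. (w\<^sup>2) ^ l) else - (\<Sum>l\<in>L. (w\<^sup>2) ^ l))"
    using cube_root_sum[OF z] by auto
  finally show ?thesis .
qed

theorem theorem4p4:
  fixes n :: nat and L :: "nat set" and S2 :: "(nat \<times> nat) set"
  assumes n: "n \<ge> 1"
    and L: "L \<subseteq> {0..<n}"
    and S2: "S2 \<subseteq> {x \<in> carrier (U n). odd (fst x)}"
    and S1_def: "S1 = {(2 * l mod (2 * n), 1) | l. l \<in> L} \<union> {((2 * n - 2 * l) mod (2 * n), 2) | l. l \<in> L}"
    and S_def: "S = S1 \<union> S2"
    and one_notin: "\<one>\<^bsub>U n\<^esub> \<notin> S"
    and S_inv: "S = (\<lambda>x. inv\<^bsub>U n\<^esub> x) ` S"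
    and SL_def: "SL = {(2 * l, 0) | l. l \<in> L}"
    and SL_inv: "SL = (\<lambda>x. inv\<^bsub>U n\<^esub> x) ` SL"
  shows "integral_cayley_U n S \<longleftrightarrow>
           (SL \<in> boolean_alg (U_A2 n)
            \<and> (\<forall>j<2*n. char_set (chi n j) S2 \<in> \<int>)
            \<and> (\<forall>k<n. \<exists>m::int. 2 * char_set_sq (U n) (psi n k) S2 = of_int m ^ 2))"
proof -
  define \<sigma> :: "complex \<Rightarrow> complex" where "\<sigma> = (\<lambda>w. \<Sum>l\<in>L. (w\<^sup>2) ^ l)"
  define \<beta> where "\<beta> = (\<lambda>w z p. sum (weight w z p) S2)"
  have spectrum: "eigenvalue (cayley_adj (U n) S (U_list n)) ev \<longleftrightarrow>
    (\<exists>w. w ^ (2 * n) = 1 \<and> (ev = 2 * \<sigma> w + \<beta> w 1 True \<or>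
      (\<exists>z. z ^ 3 = 1 \<and> z \<noteq> 1 \<and> (ev + \<sigma> w)\<^sup>2 = \<beta> w z True * \<beta> w z False)))" for ev
    unfolding S_def \<beta>_def
  proof (rule eigenvalue_cayley_U_iff[OF n])
    show "S1 \<subseteq> carrier (U n)" unfolding S1_def using n by auto
    show "even (fst x)" if "x \<in> S1" for x using that unfolding S1_def by auto
    show "S2 \<subseteq> carrier (U n)" "\<And>x. x \<in> S2 \<Longrightarrow> odd (fst x)" using S2 by auto
    show "S1 \<union> S2 = (\<lambda>x. inv\<^bsub>U n\<^esub> x) ` (S1 \<union> S2)" using S_inv unfolding S_def .
    show "sum (weight w z p) S1 = (if z = 1 then 2 * \<sigma> w else - \<sigma> w)"
      if "w ^ (2 * n) = 1" "z ^ 3 = 1" for w z p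
      unfolding S1_def \<sigma>_def
      by (rule sum_weight_S1[OF n L SL_inv[unfolded SL_def] that])
  qed
  have SL_iff: "SL \<in> boolean_alg (U_A2 n) \<longleftrightarrow> (\<forall>w. w ^ (2 * n) = 1 \<longrightarrow> \<sigma> w \<in> \<rat>)"
  proof -
    \<comment> \<open>Every n-th root of unity is the square of a 2n-th root of unity, namely of its
      complex square root.\<close>
    have "(\<forall>z::complex. z ^ n = 1 \<longrightarrow> (\<Sum>l\<in>L. z ^ l) \<in> \<rat>) \<longleftrightarrow> (\<forall>w. w ^ (2 * n) = 1 \<longrightarrow> \<sigma> w \<in> \<rat>)"
      unfolding \<sigma>_def by (metis power2_csqrt power_mult)
    then show ?thesis unfolding SL_def boolean_alg_U_A2_iff[OF n L] .
  qed
  have chi_sum: "char_set (chi n j) S2 = \<beta> (omega n ^ j) 1 True" for j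
    unfolding \<beta>_def by (rule char_set_chi)
  have psi_sum: "2 * char_set_sq (U n) (psi n k) S2 = 4 * (\<beta> w z True * \<beta> w z False)"
    if "w ^ (2 * n) = 1" "w\<^sup>2 = omega n ^ (2 * k)" "z ^ 3 = 1" "z \<noteq> 1" for w z k
  proof -
    have "char_set_sq (U n) (psi n k) S2 = 2 * (\<beta> w z True * \<beta> w z False)"
      unfolding \<beta>_def by (rule char_set_sq_psi[OF that]) (use S2 in auto)
    then show ?thesis by (metis mult.assoc mult_2 numeral_Bit0)
  qed
  have omega_power': "(omega n ^ j) ^ (2 * n) = 1" for j
    by (metis omega_power[OF n] power_mult mult.commute power_one)
  show ?thesis
  proof
    assume integral: "integral_cayley_U n S"
    have int: "ev \<in> \<int>" if "eigenvalue (cayley_adj (U n) S (U_list n)) ev" for ev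
      using integral that by (auto simp: integral_cayley_U_def integral_matrix_spec_def)
    obtain z :: complex where z: "z ^ 3 = 1" "z \<noteq> 1" using exists_primitive_cube_root by blast
    \<comment> \<open>Both signs of the square root \<mu> give eigenvalues; their sum and difference
      separate 2\<sigma> from 2\<mu>.\<close>
    have halves: "2 * \<sigma> w \<in> \<int> \<and> 2 * csqrt (\<beta> w z True * \<beta> w z False) \<in> \<int>"
      if w: "w ^ (2 * n) = 1" for w
    proof -
      have root: "- \<sigma> w + \<nu> \<in> \<int>" if "\<nu>\<^sup>2 = \<beta> w z True * \<beta> w z False" for \<nu>
      proof (rule int)
        have "(- \<sigma> w + \<nu> + \<sigma> w)\<^sup>2 = \<beta> w z True * \<beta> w z False" using that by simp
        then show "eigenvalue (cayley_adj (U n) S (U_list n)) (- \<sigma> w + \<nu>)"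
          unfolding spectrum using w z by blast
      qed
      define \<mu> where "\<mu> = csqrt (\<beta> w z True * \<beta> w z False)"
      have \<mu>: "- \<sigma> w + \<mu> \<in> \<int>" "- \<sigma> w + - \<mu> \<in> \<int>"
        by (rule root; simp add: \<mu>_def)+
      have "2 * \<sigma> w = - ((- \<sigma> w + \<mu>) + (- \<sigma> w + - \<mu>))"
        "2 * \<mu> = (- \<sigma> w + \<mu>) - (- \<sigma> w + - \<mu>)" by simp_all
      then show ?thesis
        unfolding \<mu>_def[symmetric] using \<mu> Ints_add Ints_diff Ints_minus by metis
    qed
    have "\<sigma> w \<in> \<rat>" if w: "w ^ (2 * n) = 1" for w
    proof -
      have "2 * \<sigma> w / 2 \<in> \<rat>" using halves[OF w] Ints_subset_Rats by (intro Rats_divide) auto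
      then show ?thesis by simp
    qed
    then have "SL \<in> boolean_alg (U_A2 n)" by (simp add: SL_iff)
    moreover have "char_set (chi n j) S2 \<in> \<int>" for j
    proof -
      let ?w = "omega n ^ j"
      \<comment> \<open>The eigenvalue of the linear character is an integer, and subtracting the
        integer 2\<sigma> leaves \<chi>_j(S_2).\<close>
      have "2 * \<sigma> ?w + \<beta> ?w 1 True \<in> \<int>"
        using omega_power'[of j] by (intro int) (unfold spectrum, blast)
      from Ints_diff[OF this conjunct1[OF halves[OF omega_power'[of j]]]] show ?thesis
        by (simp add: chi_sum)
    qed
    moreover have "\<exists>m::int. 2 * char_set_sq (U n) (psi n k) S2 = of_int m ^ 2" for k
    proof -
      let ?w = "omega n ^ k"
      obtain m where m: "2 * csqrt (\<beta> ?w z True * \<beta> ?w z False) = of_int m"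
        using halves[OF omega_power', of k] by (auto elim: Ints_cases)
      have "2 * char_set_sq (U n) (psi n k) S2 = 4 * (\<beta> ?w z True * \<beta> ?w z False)"
        using omega_power'[of k] z by (intro psi_sum) (auto simp: mult.commute simp flip: power_mult)
      also have "\<dots> = (2 * csqrt (\<beta> ?w z True * \<beta> ?w z False))\<^sup>2"
        by (simp add: power_mult_distrib)
      finally show ?thesis unfolding m by blast
    qed
    ultimately show "SL \<in> boolean_alg (U_A2 n)
      \<and> (\<forall>j<2*n. char_set (chi n j) S2 \<in> \<int>)
      \<and> (\<forall>k<n. \<exists>m::int. 2 * char_set_sq (U n) (psi n k) S2 = of_int m ^ 2)" by blast
  next
    assume rhs: "SL \<in> boolean_alg (U_A2 n)
      \<and> (\<forall>j<2*n. char_set (chi n j) S2 \<in> \<int>)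
      \<and> (\<forall>k<n. \<exists>m::int. 2 * char_set_sq (U n) (psi n k) S2 = of_int m ^ 2)"
    have "ev \<in> \<int>" if ev: "eigenvalue (cayley_adj (U n) S (U_list n)) ev" for ev
    proof (rule rational_eigenvalue_cayley_adj[OF ev])
      obtain w where w: "w ^ (2 * n) = 1" and
        cases: "ev = 2 * \<sigma> w + \<beta> w 1 True \<or>
          (\<exists>z. z ^ 3 = 1 \<and> z \<noteq> 1 \<and> (ev + \<sigma> w)\<^sup>2 = \<beta> w z True * \<beta> w z False)"
        using ev unfolding spectrum by blast
      have rat: "\<sigma> w \<in> \<rat>" using rhs w by (simp add: SL_iff)
      obtain j where j: "j < 2 * n" "w = omega n ^ j" using root_of_unity_omega[OF n w] by blast
      from cases show "ev \<in> \<rat>"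
      proof
        assume "ev = 2 * \<sigma> w + \<beta> w 1 True"
        moreover have "\<beta> w 1 True \<in> \<rat>"
          using rhs j Ints_subset_Rats by (auto simp: chi_sum)
        ultimately show ?thesis using rat by simp
      next
        assume "\<exists>z. z ^ 3 = 1 \<and> z \<noteq> 1 \<and> (ev + \<sigma> w)\<^sup>2 = \<beta> w z True * \<beta> w z False"
        then obtain z where z: "z ^ 3 = 1" "z \<noteq> 1" "(ev + \<sigma> w)\<^sup>2 = \<beta> w z True * \<beta> w z False"
          by blast
        \<comment> \<open>The square of \<open>w\<close> depends only on j modulo n, which matches
          the index range k < n of the degree-two characters.\<close>
        have "w\<^sup>2 = ((omega n)\<^sup>2) ^ j" by (simp add: j(2) mult.commute flip: power_mult)
        also have "\<dots> = ((omega n)\<^sup>2) ^ (j mod n)"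
          using omega_power[OF n] by (intro power_mod_root_of_unity[symmetric]) (simp add: power_mult)
        finally have "w\<^sup>2 = omega n ^ (2 * (j mod n))" by (simp add: power_mult)
        then have "2 * char_set_sq (U n) (psi n (j mod n)) S2 = 4 * (ev + \<sigma> w)\<^sup>2"
          unfolding z(3) by (intro psi_sum w z)
        also have "\<dots> = (2 * (ev + \<sigma> w))\<^sup>2" by (simp add: power2_eq_square algebra_simps)
        finally have "2 * char_set_sq (U n) (psi n (j mod n)) S2 = (2 * (ev + \<sigma> w))\<^sup>2" .
        moreover have "j mod n < n" using n by simp
        then obtain m :: int where "2 * char_set_sq (U n) (psi n (j mod n)) S2 = of_int m ^ 2"
          using rhs by blast
        ultimately have "(2 * (ev + \<sigma> w))\<^sup>2 = (of_int m)\<^sup>2" by simp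
        then have "2 * (ev + \<sigma> w) = of_int m \<or> 2 * (ev + \<sigma> w) = - of_int m"
          by (simp only: power2_eq_iff)
        \<comment> \<open>Halves may appear at this point, but only rationality is claimed;
          integrality follows from the integer adjacency matrix.\<close>
        then have "ev = of_int m / 2 - \<sigma> w \<or> ev = - of_int m / 2 - \<sigma> w"
          by (auto simp: field_simps)
        then show ?thesis using rat by auto
      qed
    qed
    then show "integral_cayley_U n S"
      by (simp add: integral_cayley_U_def integral_matrix_spec_def)
  qed
qed

end
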